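(* Let $n\ge1$, let $L,\bar M\in\mathbb{R}^{n\times n}$, let $M\in\mathbb{R}^{n\times n}$ be diagonal with positive diagonal entries, let $\mathcal I\subseteq\{1,\dots,n\}$ and $\mathcal A=\{1,\dots,n\}\setminus\mathcal I$, and let $\alpha>0$ be such that $\sqrt\alpha L+\bar M\Pi_{\mathcal I}$ is nonsingular. Let $$\zeta=\left\|M^{\frac12}\left(\sqrt{\alpha}L+\bar M\Pi_{\mathcal I}\right)^{-1}\sqrt{\alpha}\,L\,M^{-\frac12}\right\| ,$$ and let $J^{aug}$, $J^{red}$, $\mathcal P_{aug}^{IPF}$, $\mathcal P_{red}^{IPF}$ be the matrices defined in the context. i) Every eigenvalue $\lambda$ of $(\mathcal P_{aug}^{IPF})^{-1}J^{aug}$ satisfies $\lambda\in\{1\}\cup[\frac12,\ \zeta^2+(1+\zeta)^2]$. Moreover, there are at least $3n+|\mathcal A|-2|\mathcal I|$ eigenvalues (counted with multiplicity) equal to $1$. ii) Every eigenvalue $\lambda$ of $(\mathcal P_{red}^{IPF})^{-1}J^{red}$ satisfies $\lambda\in\{1\}\cup[\frac12,\ \zeta^2+(1+\zeta)^2]$. Moreover, there are at least $2n-2|\mathcal I|$ eigenvalues (counted with multiplicity) equal to $1$.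
   Context: For an index set $\mathcal C\subseteq\{1,\dots,n\}$, $\Pi_{\mathcal C}\in\mathbb{R}^{n\times n}$ is the diagonal $0/1$ matrix with ones exactly at the indices in $\mathcal C$, and $P_{\mathcal C}\in\mathbb{R}^{|\mathcal C|\times n}$ consists of the rows of $\Pi_{\mathcal C}$ with indices in $\mathcal C$ (so $P_{\mathcal C}^TP_{\mathcal C}=\Pi_{\mathcal C}$). $|\mathcal C|$ is the number of elements of $\mathcal C$. $\|\cdot\|$ is the spectral norm. Multiplicity means algebraic multiplicity. The augmented and reduced matrices are $$J^{aug}=\begin{bmatrix} M & 0 & L^T & 0 \\ 0 & \alpha M & -\bar M^T & M P_{\mathcal A}^T \\ L & -\bar M & 0 & 0 \\ 0 & P_{\mathcal A} M & 0 & 0 \end{bmatrix},\qquad J^{red}=\begin{bmatrix} M & L^T \\ L & -\frac1\alpha\bar M M^{-1}\Pi_{\mathcal I}\bar M^T \end{bmatrix}.$$ Let $$\widehat{\mathbb S}=(\sqrt\alpha L+\bar M\Pi_{\mathcal I})M^{-1}(\sqrt\alpha L+\bar M\Pi_{\mathcal I})^T,$$ $$\widehat S=\frac1\alpha\begin{bmatrix} I & -\bar M\Pi_{\mathcal A}M^{-1}P_{\mathcal A}^T \\ 0 & I \end{bmatrix}\begin{bmatrix} \widehat{\mathbb S} & 0 \\ 0 & P_{\mathcal A}MP_{\mathcal A}^T \end{bmatrix}\begin{bmatrix} I & -\bar M\Pi_{\mathcal A}M^{-1}P_{\mathcal A}^T \\ 0 & I \end{bmatrix}^T,$$ $$J_{11}=\begin{bmatrix}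 M & 0 \\ 0 & \alpha M \end{bmatrix},\qquad J_{12}=\begin{bmatrix} L & -\bar M \\ 0 & P_{\mathcal A}M \end{bmatrix}.$$ The indefinite preconditioners are $$\mathcal P_{aug}^{IPF}=\begin{bmatrix} I & 0 \\ J_{12} J_{11}^{-1} & I \end{bmatrix}\begin{bmatrix} J_{11} & 0 \\ 0 & -\widehat S \end{bmatrix}\begin{bmatrix} I & J_{11}^{-1}J_{12}^T \\ 0 & I \end{bmatrix},$$ $$\mathcal P_{red}^{IPF}=\begin{bmatrix} I & 0 \\ L M^{-1} & I \end{bmatrix}\begin{bmatrix} M & 0 \\ 0 & -\frac1\alpha\widehat{\mathbb S} \end{bmatrix}\begin{bmatrix} I & M^{-1}L^T \\ 0 & I \end{bmatrix}.$$ *)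

theory Defs
  imports
    "Jordan_Normal_Form.Gauss_Jordan_Elimination"
    "Jordan_Normal_Form.Char_Poly"
    "Jordan_Normal_Form.DL_Submatrix"
    Complex_Main
begin

text \<open>
  Matrices are those of \<open>Jordan_Normal_Form\<close>, so rows and columns are numbered from \<open>0\<close>:
  the index set \<open>{1,\<dots>,n}\<close> becomes \<open>{..<n}\<close>.
\<close>

text \<open>Only meaningful for nonsingular square matrices; see \<open>minv_inverse\<close>.\<close>

definition minv :: "'a :: field mat \<Rightarrow> 'a mat" where
  "minv A = the (mat_inverse A)"

definition vec_norm2 :: "real vec \<Rightarrow> real" where
  "vec_norm2 v = sqrt (v \<bullet> v)"

text \<open>The operator norm induced by the Euclidean norms; only meaningful if \<open>dim_col A > 0\<close>.\<close>

definition spectral_norm :: "real mat \<Rightarrow> real" where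
  "spectral_norm A =
     (SUP x \<in> carrier_vec (dim_col A) - {0\<^sub>v (dim_col A)}. vec_norm2 (A *\<^sub>v x) / vec_norm2 x)"

text \<open>
  The real power \<open>M\<^sup>p\<close> of a diagonal matrix with positive diagonal, used for
  \<open>p = 1/2\<close> and \<open>p = -1/2\<close>.
\<close>

definition diag_powr :: "real mat \<Rightarrow> real \<Rightarrow> real mat" where
  "diag_powr M p = mat_diag (dim_row M) (\<lambda>i. (M $$ (i, i)) powr p)"

definition Pi_mat :: "nat \<Rightarrow> nat set \<Rightarrow> real mat" where
  "Pi_mat n C = mat_diag n (\<lambda>i. if i \<in> C then 1 else 0)"

definition P_mat :: "nat \<Rightarrow> nat set \<Rightarrow> real mat" where
  "P_mat n C = submatrix (Pi_mat n C) C UNIV"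

text \<open>Below, \<open>Mb\<close> stands for \<open>\<bar>M\<close> (M bar), \<open>I\<close> and \<open>A\<close> for the two index sets.\<close>

definition J11 :: "nat \<Rightarrow> real \<Rightarrow> real mat \<Rightarrow> real mat" where
  "J11 n \<alpha> M = four_block_mat M (0\<^sub>m n n) (0\<^sub>m n n) (\<alpha> \<cdot>\<^sub>m M)"

definition J12 :: "nat \<Rightarrow> real mat \<Rightarrow> real mat \<Rightarrow> real mat \<Rightarrow> nat set \<Rightarrow> real mat" where
  "J12 n M L Mb A =
     four_block_mat L (- Mb)
       (0\<^sub>m (card A) n) (P_mat n A * M)"

definition J_aug :: "nat \<Rightarrow> real \<Rightarrow> real mat \<Rightarrow> real mat \<Rightarrow> real mat \<Rightarrow> nat set \<Rightarrow> real mat" where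
  "J_aug n \<alpha> M L Mb A =
     four_block_mat
       (four_block_mat
          M          (0\<^sub>m n n)
          (0\<^sub>m n n)  (\<alpha> \<cdot>\<^sub>m M))
       (four_block_mat
          (L\<^sup>T)      (0\<^sub>m n (card A))
          (- (Mb\<^sup>T)) (M * (P_mat n A)\<^sup>T))
       (four_block_mat
          L                  (- Mb)
          (0\<^sub>m (card A) n)  (P_mat n A * M))
       (four_block_mat
          (0\<^sub>m n n)         (0\<^sub>m n (card A))
          (0\<^sub>m (card A) n)  (0\<^sub>m (card A) (card A)))"

definition J_red :: "nat \<Rightarrow> real \<Rightarrow> real mat \<Rightarrow> real mat \<Rightarrow> real mat \<Rightarrow> nat set \<Rightarrow> real mat" where
  "J_red n \<alpha> M L Mb I =
     four_block_mat
       M (L\<^sup>T)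
       L (- ((1 / \<alpha>) \<cdot>\<^sub>m (Mb * minv M * Pi_mat n I * Mb\<^sup>T)))"

definition S_red_hat :: "nat \<Rightarrow> real \<Rightarrow> real mat \<Rightarrow> real mat \<Rightarrow> real mat \<Rightarrow> nat set \<Rightarrow> real mat" where
  "S_red_hat n \<alpha> M L Mb I =
     (sqrt \<alpha> \<cdot>\<^sub>m L + Mb * Pi_mat n I) * minv M * (sqrt \<alpha> \<cdot>\<^sub>m L + Mb * Pi_mat n I)\<^sup>T"

definition S_aug_hat ::
  "nat \<Rightarrow> real \<Rightarrow> real mat \<Rightarrow> real mat \<Rightarrow> real mat \<Rightarrow> nat set \<Rightarrow> nat set \<Rightarrow> real mat" where
  "S_aug_hat n \<alpha> M L Mb I A =
     (let U = four_block_mat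
                (1\<^sub>m n)            (- (Mb * Pi_mat n A * minv M * (P_mat n A)\<^sup>T))
                (0\<^sub>m (card A) n)  (1\<^sub>m (card A));
          D = four_block_mat
                (S_red_hat n \<alpha> M L Mb I) (0\<^sub>m n (card A))
                (0\<^sub>m (card A) n)         (P_mat n A * M * (P_mat n A)\<^sup>T)
      in (1 / \<alpha>) \<cdot>\<^sub>m (U * D * U\<^sup>T))"

definition IPF_aug ::
  "nat \<Rightarrow> real \<Rightarrow> real mat \<Rightarrow> real mat \<Rightarrow> real mat \<Rightarrow> nat set \<Rightarrow> nat set \<Rightarrow> real mat" where
  "IPF_aug n \<alpha> M L Mb I A =
     (let a = card A; B = J12 n M L Mb A; Kinv = minv (J11 n \<alpha> M) in
        four_block_mat (1\<^sub>m (2 * n)) (0\<^sub>m (2 * n) (n + a))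
                       (B * Kinv)   (1\<^sub>m (n + a))
      * four_block_mat (J11 n \<alpha> M)         (0\<^sub>m (2 * n) (n + a))
                       (0\<^sub>m (n + a) (2 * n)) (- S_aug_hat n \<alpha> M L Mb I A)
      * four_block_mat (1\<^sub>m (2 * n))         (Kinv * B\<^sup>T)
                       (0\<^sub>m (n + a) (2 * n)) (1\<^sub>m (n + a)))"

definition IPF_red :: "nat \<Rightarrow> real \<Rightarrow> real mat \<Rightarrow> real mat \<Rightarrow> real mat \<Rightarrow> nat set \<Rightarrow> real mat" where
  "IPF_red n \<alpha> M L Mb I =
     four_block_mat (1\<^sub>m n) (0\<^sub>m n n)
                    (L * minv M) (1\<^sub>m n)
   * four_block_mat M (0\<^sub>m n n)
                    (0\<^sub>m n n) (- ((1 / \<alpha>) \<cdot>\<^sub>m S_red_hat n \<alpha> M L Mb I))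
   * four_block_mat (1\<^sub>m n) (minv M * L\<^sup>T)
                    (0\<^sub>m n n) (1\<^sub>m n)"

definition zeta :: "nat \<Rightarrow> real \<Rightarrow> real mat \<Rightarrow> real mat \<Rightarrow> real mat \<Rightarrow> nat set \<Rightarrow> real" where
  "zeta n \<alpha> M L Mb I =
     spectral_norm
       (diag_powr M (1/2) * minv (sqrt \<alpha> \<cdot>\<^sub>m L + Mb * Pi_mat n I)
        * (sqrt \<alpha> \<cdot>\<^sub>m L) * diag_powr M (- 1/2))"

text \<open>
  Real matrices are viewed as complex ones, so that all of their eigenvalues are considered and
  reality of the spectrum is part of what has to be shown.
\<close>

abbreviation cmat :: "real mat \<Rightarrow> complex mat" where
  "cmat \<equiv> map_mat complex_of_real"

definition alg_mult :: "complex mat \<Rightarrow> complex \<Rightarrow> nat" where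
  "alg_mult A k = order k (char_poly A)"

lemma minv_inverse:
  fixes A :: "'a :: field mat"
  assumes "A \<in> carrier_mat n n" and "invertible_mat A"
  shows "minv A \<in> carrier_mat n n" and "A * minv A = 1\<^sub>m n" and "minv A * A = 1\<^sub>m n"
proof -
  obtain B where B: "inverts_mat A B" "inverts_mat B A"
    using assms(2) unfolding invertible_mat_def by blast
  have AB: "A * B = 1\<^sub>m n" using B(1) assms(1) unfolding inverts_mat_def by simp
  have dc: "dim_col B = n" using arg_cong[OF AB, of dim_col] by simp
  have BA: "B * A = 1\<^sub>m (dim_row B)" using B(2) unfolding inverts_mat_def .
  have dr: "dim_row B = n" using arg_cong[OF BA, of dim_col] assms(1) by simp
  have Bc: "B \<in> carrier_mat n n" using dc dr by blast
  have "A \<in> Units (ring_mat TYPE('a) n ())"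
    using assms(1) Bc AB BA dr unfolding Units_def ring_mat_def by auto
  then obtain C where C: "mat_inverse A = Some C"
    using mat_inverse(1)[OF assms(1), where b = "()"] by (cases "mat_inverse A") auto
  note mat_inverse(2)[OF assms(1) C]
  then show "minv A \<in> carrier_mat n n" "A * minv A = 1\<^sub>m n" "minv A * A = 1\<^sub>m n"
    unfolding minv_def C by auto
qed

lemma pick_card:
  assumes "C \<subseteq> {..<n}" and "i < card C"
  shows "pick C i \<in> C" "pick C i < n"
  using pick_in_set_le[OF assms(2)] assms(1) by auto

lemma P_mat_carrier:
  assumes "C \<subseteq> {..<n}"
  shows "P_mat n C \<in> carrier_mat (card C) n"
proof -
  have "{i. i < n \<and> i \<in> C} = C" using assms by auto
  then show ?thesis
    by (intro carrier_matI) (simp_all add: P_mat_def dim_submatrix Pi_mat_def mat_diag_def)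
qed

lemma P_mat_index:
  assumes "C \<subseteq> {..<n}" and "i < card C" and "j < n"
  shows "P_mat n C $$ (i, j) = (if pick C i = j then 1 else 0)"
proof -
  have e: "{i. i < n \<and> i \<in> C} = C" using assms(1) by auto
  show ?thesis
    using pick_card[OF assms(1,2)] assms(2,3)
    by (auto simp: P_mat_def submatrix_def Pi_mat_def mat_diag_def e pick_UNIV)
qed

lemma P_mat_transpose_mult:
  assumes "C \<subseteq> {..<n}"
  shows "(P_mat n C)\<^sup>T * P_mat n C = Pi_mat n C"
proof (rule eq_matI)
  note car = P_mat_carrier[OF assms]
  show "dim_row ((P_mat n C)\<^sup>T * P_mat n C) = dim_row (Pi_mat n C)"
    "dim_col ((P_mat n C)\<^sup>T * P_mat n C) = dim_col (Pi_mat n C)"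
    using car by (auto simp: Pi_mat_def mat_diag_def)
  fix i j assume "i < dim_row (Pi_mat n C)" "j < dim_col (Pi_mat n C)"
  then have ij: "i < n" "j < n" by (auto simp: Pi_mat_def mat_diag_def)
  have fin: "finite C" using assms finite_subset by blast
  have bij: "bij_betw (pick C) {0..<card C} C"
  proof -
    have inj: "inj_on (pick C) {0..<card C}"
      by (rule linorder_inj_onI') (metis atLeastLessThan_iff nat_neq_iff pick_mono_le)
    have "pick C ` {0..<card C} \<subseteq> C" using pick_in_set_le by auto
    moreover have "card (pick C ` {0..<card C}) = card C" using card_image[OF inj] by simp
    ultimately show ?thesis using inj fin card_subset_eq unfolding bij_betw_def by blast
  qed
  have "((P_mat n C)\<^sup>T * P_mat n C) $$ (i, j)
      = (\<Sum>k = 0..<card C. P_mat n C $$ (k, i) * P_mat n C $$ (k, j))"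
    using car ij by (simp add: scalar_prod_def)
  also have "\<dots> = (\<Sum>k = 0..<card C. (if pick C k = i \<and> i = j then 1 else 0))"
    using ij by (intro sum.cong) (auto simp: P_mat_index[OF assms])
  also have "\<dots> = (\<Sum>c\<in>C. (if c = i \<and> i = j then 1 else 0))"
    by (rule sum.reindex_bij_betw[OF bij])
  also have "\<dots> = (if i = j \<and> i \<in> C then 1 else 0)"
    using fin by (cases "i = j") simp_all
  also have "\<dots> = Pi_mat n C $$ (i, j)" using ij by (simp add: Pi_mat_def mat_diag_def)
  finally show "((P_mat n C)\<^sup>T * P_mat n C) $$ (i, j) = Pi_mat n C $$ (i, j)" .
qed

end

theory Submission
  imports Defs "HOL-Analysis.Convex"
begin

text \<open>
Both systems have the block form \<open>J = [K, B\<^sup>T; B, B K\<inverse> B\<^sup>T - S]\<close>, and the preconditioner is the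
block \<open>LDU\<close> factorization of \<open>J\<close> with the Schur complement \<open>S\<close> replaced by an approximation \<open>S'\<close>.
The triangular factors are shared, so the preconditioned matrix is similar to
\<open>diag(1, S'\<inverse> S)\<close>, and only \<open>S'\<inverse> S\<close> has to be studied.

Put \<open>W = sqrt \<alpha> L + Mb \<Pi>\<^sub>I\<close>, \<open>Z = M\<^sup>1\<^sup>/\<^sup>2 W\<inverse> (sqrt \<alpha> L) M\<^sup>-\<^sup>1\<^sup>/\<^sup>2\<close>, \<open>Q = M\<^sup>1\<^sup>/\<^sup>2 W\<inverse> Mb \<Pi>\<^sub>I M\<^sup>-\<^sup>1\<^sup>/\<^sup>2\<close>
and \<open>G = W M\<^sup>-\<^sup>1\<^sup>/\<^sup>2\<close>. Then \<open>Z + Q = 1\<close>, the spectral norm of \<open>Z\<close> is \<open>\<zeta>\<close>, and for the reduced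
system \<open>S' = (1/\<alpha>) G G\<^sup>T\<close> and \<open>S = (1/\<alpha>) G H G\<^sup>T\<close> with one symmetric matrix
\<open>H = Z Z\<^sup>T + Q Q\<^sup>T\<close> (\<open>schur_complement_congruence\<close>). For the augmented system both Schur
complements carry a further congruence by a unit triangular matrix and a common block
\<open>P\<^sub>A M P\<^sub>A\<^sup>T\<close>, which turns \<open>H\<close> into \<open>diag(H, 1)\<close>. Hence in both cases the characteristic polynomial
of the preconditioned matrix is that of \<open>H\<close> times a power of \<open>x - 1\<close>, with exponent \<open>n\<close> for the
reduced and \<open>2n + |A|\<close> for the augmented system (\<open>char_poly_reduced\<close>, \<open>char_poly_augmented\<close>).

The eigenvalues of \<open>H\<close> are real, and one with eigenvector \<open>c\<close> equals
\<open>(|a|\<^sup>2 + |c - a|\<^sup>2) / |c|\<^sup>2\<close>, where \<open>a = Z\<^sup>T c\<close>. This is at least \<open>1/2\<close> by the parallelogram law,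
and since \<open>|a| \<le> \<zeta> |c|\<close> and \<open>|c - a| \<le> (1 + \<zeta>) |c|\<close> it is at most \<open>\<zeta>\<^sup>2 + (1 + \<zeta>)\<^sup>2\<close>
(\<open>eigenvalue_bounds\<close>).

For the multiplicity of \<open>1\<close>, expanding \<open>(Z + Q) (Z + Q)\<^sup>T = 1\<close> gives \<open>H = 1 - (Z Q\<^sup>T + Q Z\<^sup>T)\<close>. As
\<open>Q\<close> contains the factor \<open>\<Pi>\<^sub>I\<close>, it factors through dimension \<open>|I|\<close>, so \<open>H\<close> differs from the
identity by a product through dimension \<open>2|I|\<close>. The determinant identity
\<open>c\<^sup>m det (c 1\<^sub>n + N R) = c\<^sup>n det (c 1\<^sub>m + R N)\<close>, taken at \<open>c = x - 1\<close>, then shows that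
\<open>(x - 1)\<^sup>n\<close> divides \<open>(x - 1)\<^sup>2\<^sup>|\<^sup>I\<^sup>|\<close> times the characteristic polynomial of \<open>H\<close>
(\<open>char_poly_sum_of_squares_low_rank\<close>).
\<close>

(* From here on the infix dot is the scalar product of vectors of explicit dimension. *)
no_notation inner (infix \<open>\<bullet>\<close> 70)

section \<open>Euclidean norm and spectral norm\<close>

lemma scalar_prod_self_ge_0: "(v :: real vec) \<bullet> v \<ge> 0"
  by (simp add: scalar_prod_def sum_nonneg)

lemma scalar_prod_self_eq_0_iff:
  assumes "(v :: real vec) \<in> carrier_vec n"
  shows "v \<bullet> v = 0 \<longleftrightarrow> v = 0\<^sub>v n"
  using assms by (auto simp: scalar_prod_def sum_nonneg_eq_0_iff intro!: eq_vecI)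

lemma vec_norm2_nonneg: "vec_norm2 v \<ge> 0"
  by (simp add: vec_norm2_def scalar_prod_self_ge_0)

lemma vec_norm2_square: "(vec_norm2 v)\<^sup>2 = v \<bullet> v"
  by (simp add: vec_norm2_def scalar_prod_self_ge_0)

lemma vec_norm2_pos:
  assumes "v \<in> carrier_vec n" and "v \<noteq> 0\<^sub>v n"
  shows "vec_norm2 v > 0"
  using scalar_prod_self_eq_0_iff[OF assms(1)] assms(2) scalar_prod_self_ge_0[of v]
  by (simp add: vec_norm2_def)

lemma scalar_prod_square_le:
  assumes "(v :: real vec) \<in> carrier_vec n" and "w \<in> carrier_vec n"
  shows "(v \<bullet> w)\<^sup>2 \<le> (v \<bullet> v) * (w \<bullet> w)"
  using Cauchy_Schwarz_ineq_sum[of "\<lambda>i. v $ i" "\<lambda>i. w $ i" "{0..<n}"] assms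
  by (simp add: scalar_prod_def power2_eq_square)

lemma scalar_prod_le_vec_norm2:
  assumes "v \<in> carrier_vec n" and "w \<in> carrier_vec n"
  shows "\<bar>v \<bullet> w\<bar> \<le> vec_norm2 v * vec_norm2 w"
  using real_sqrt_le_mono[OF scalar_prod_square_le[OF assms]]
  by (simp add: vec_norm2_def real_sqrt_mult)

text \<open>Supplies the upper bound of the set of quotients whose supremum defines the spectral norm; without
it the supremum would carry no information. Cauchy-Schwarz on each row gives the Frobenius norm.\<close>

lemma mult_mat_vec_bounded:
  assumes A: "(A :: real mat) \<in> carrier_mat m n"
  obtains K where "\<And>x. x \<in> carrier_vec n \<Longrightarrow> vec_norm2 (A *\<^sub>v x) \<le> K * vec_norm2 x"
proof
  fix x :: "real vec" assume x: "x \<in> carrier_vec n"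
  let ?K = "\<Sum>i<m. row A i \<bullet> row A i"
  have "(A *\<^sub>v x) \<bullet> (A *\<^sub>v x) = (\<Sum>i<m. (row A i \<bullet> x)\<^sup>2)"
    using A by (auto simp: scalar_prod_def power2_eq_square atLeast0LessThan)
  also have "\<dots> \<le> (\<Sum>i<m. (row A i \<bullet> row A i) * (x \<bullet> x))"
    using A x by (intro sum_mono scalar_prod_square_le[of _ n]) auto
  also have "\<dots> = ?K * (x \<bullet> x)"
    by (simp add: sum_distrib_right)
  finally have "sqrt ((A *\<^sub>v x) \<bullet> (A *\<^sub>v x)) \<le> sqrt (?K * (x \<bullet> x))"
    by (rule real_sqrt_le_mono)
  then show "vec_norm2 (A *\<^sub>v x) \<le> sqrt ?K * vec_norm2 x"
    by (simp add: vec_norm2_def real_sqrt_mult)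
qed

lemma spectral_norm_bound:
  assumes A: "A \<in> carrier_mat m n" and x: "x \<in> carrier_vec n"
  shows "vec_norm2 (A *\<^sub>v x) \<le> spectral_norm A * vec_norm2 x"
proof (cases "x = 0\<^sub>v n")
  case True
  have "A *\<^sub>v 0\<^sub>v n = 0\<^sub>v m" using A by (auto intro!: eq_vecI)
  then show ?thesis using True by (simp add: vec_norm2_def)
next
  case False
  let ?q = "\<lambda>x. vec_norm2 (A *\<^sub>v x) / vec_norm2 x"
  obtain K where K: "\<And>x. x \<in> carrier_vec n \<Longrightarrow> vec_norm2 (A *\<^sub>v x) \<le> K * vec_norm2 x"
    using mult_mat_vec_bounded[OF A] by blast
  have "bdd_above (?q ` (carrier_vec n - {0\<^sub>v n}))"
    using K vec_norm2_pos[of _ n] by (intro bdd_aboveI2[of _ _ K]) (auto simp: divide_le_eq)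
  then have "?q x \<le> spectral_norm A"
    unfolding spectral_norm_def using A x False by (intro cSUP_upper) auto
  then show ?thesis using vec_norm2_pos[OF x False] by (simp add: divide_le_eq)
qed

lemma scalar_prod_transpose:
  assumes "(A :: 'a :: comm_semiring_0 mat) \<in> carrier_mat m n"
    and "x \<in> carrier_vec n" and "y \<in> carrier_vec m"
  shows "y \<bullet> (A *\<^sub>v x) = (A\<^sup>T *\<^sub>v y) \<bullet> x"
proof -
  have "(A\<^sup>T *\<^sub>v y) \<bullet> x = (\<Sum>j<n. (\<Sum>i<m. A $$ (i, j) * y $ i) * x $ j)"
    using assms by (auto simp: scalar_prod_def atLeast0LessThan)
  also have "\<dots> = (\<Sum>j<n. \<Sum>i<m. y $ i * (A $$ (i, j) * x $ j))"
    by (simp add: sum_distrib_left sum_distrib_right ac_simps)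
  also have "\<dots> = (\<Sum>i<m. \<Sum>j<n. y $ i * (A $$ (i, j) * x $ j))"
    by (rule sum.swap)
  also have "\<dots> = y \<bullet> (A *\<^sub>v x)"
    using assms by (auto simp: scalar_prod_def atLeast0LessThan sum_distrib_left)
  finally show ?thesis by simp
qed

text \<open>A matrix and its transpose have the same operator norm; the inequality needed here comes from
\<open>|A\<^sup>T x|\<^sup>2 = x \<bullet> A (A\<^sup>T x) \<le> |x| \<parallel>A\<parallel> |A\<^sup>T x|\<close> after cancelling \<open>|A\<^sup>T x|\<close>.\<close>

lemma spectral_norm_bound_transpose:
  assumes A: "A \<in> carrier_mat n n" and x: "x \<in> carrier_vec n"
  shows "vec_norm2 (A\<^sup>T *\<^sub>v x) \<le> spectral_norm A * vec_norm2 x"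
proof -
  let ?y = "A\<^sup>T *\<^sub>v x"
  have y: "?y \<in> carrier_vec n" using A x by auto
  have "(vec_norm2 ?y)\<^sup>2 = x \<bullet> (A *\<^sub>v ?y)"
    using scalar_prod_transpose[OF A y x] by (simp add: vec_norm2_square)
  also have "\<dots> \<le> vec_norm2 x * vec_norm2 (A *\<^sub>v ?y)"
    using scalar_prod_le_vec_norm2[of x n "A *\<^sub>v ?y"] A x y by auto
  also have "\<dots> \<le> vec_norm2 x * (spectral_norm A * vec_norm2 ?y)"
    by (intro mult_left_mono spectral_norm_bound[OF A y] vec_norm2_nonneg)
  finally have sq: "vec_norm2 ?y * vec_norm2 ?y \<le> (spectral_norm A * vec_norm2 x) * vec_norm2 ?y"
    by (simp add: power2_eq_square ac_simps)
  show ?thesis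
  proof (cases "vec_norm2 ?y = 0")
    case True
    have "0 \<le> spectral_norm A * vec_norm2 x"
      using spectral_norm_bound[OF A x] vec_norm2_nonneg[of "A *\<^sub>v x"] by linarith
    then show ?thesis using True by simp
  next
    case False
    then have "vec_norm2 ?y > 0" using vec_norm2_nonneg[of ?y] by linarith
    then show ?thesis using sq by (rule mult_right_le_imp_le[rotated])
  qed
qed

section \<open>Eigenvalues of a sum of two Gram matrices\<close>

text \<open>Splitting a complex eigenvector into \<open>x + i y\<close> and the eigenvalue into \<open>p + i q\<close> turns the
eigenvalue equation into \<open>H x = p x - q y\<close> and \<open>H y = q x + p y\<close>. Symmetry equates \<open>x \<bullet> H y\<close> with
\<open>H x \<bullet> y\<close>, which leaves \<open>q (|x|\<^sup>2 + |y|\<^sup>2) = 0\<close>. So \<open>q = 0\<close>, and whichever of \<open>x\<close>, \<open>y\<close> is nonzero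
is a real eigenvector.\<close>

lemma eigenvalue_symmetric_real:
  fixes H :: "real mat"
  assumes H: "H \<in> carrier_mat n n" and sym: "H\<^sup>T = H"
    and ev: "eigenvalue (cmat H) ev"
  obtains p c where "ev = complex_of_real p" and "c \<in> carrier_vec n" and "c \<noteq> 0\<^sub>v n"
    and "H *\<^sub>v c = p \<cdot>\<^sub>v c"
proof -
  obtain w where w: "w \<in> carrier_vec n" "w \<noteq> 0\<^sub>v n" "cmat H *\<^sub>v w = ev \<cdot>\<^sub>v w"
    using ev H unfolding eigenvalue_def eigenvector_def by auto
  define x where "x = map_vec Re w"
  define y where "y = map_vec Im w"
  let ?p = "Re ev" and ?q = "Im ev"
  have xy: "x \<in> carrier_vec n" "y \<in> carrier_vec n" using w(1) by (auto simp: x_def y_def)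
  have Hx: "H *\<^sub>v x = ?p \<cdot>\<^sub>v x - ?q \<cdot>\<^sub>v y"
  proof (rule eq_vecI)
    fix i assume "i < dim_vec (?p \<cdot>\<^sub>v x - ?q \<cdot>\<^sub>v y)"
    then have i: "i < n" using xy by simp
    have "Re ((cmat H *\<^sub>v w) $ i) = (H *\<^sub>v x) $ i"
      using H w(1) i by (simp add: scalar_prod_def x_def)
    then show "(H *\<^sub>v x) $ i = (?p \<cdot>\<^sub>v x - ?q \<cdot>\<^sub>v y) $ i"
      using i w(1) unfolding w(3) by (simp add: x_def y_def)
  qed (use H xy in auto)
  have Hy: "H *\<^sub>v y = ?q \<cdot>\<^sub>v x + ?p \<cdot>\<^sub>v y"
  proof (rule eq_vecI)
    fix i assume "i < dim_vec (?q \<cdot>\<^sub>v x + ?p \<cdot>\<^sub>v y)"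
    then have i: "i < n" using xy by simp
    have "Im ((cmat H *\<^sub>v w) $ i) = (H *\<^sub>v y) $ i"
      using H w(1) i by (simp add: scalar_prod_def y_def)
    then show "(H *\<^sub>v y) $ i = (?q \<cdot>\<^sub>v x + ?p \<cdot>\<^sub>v y) $ i"
      using i w(1) unfolding w(3) by (simp add: x_def y_def)
  qed (use H xy in auto)
  have nz: "x \<noteq> 0\<^sub>v n \<or> y \<noteq> 0\<^sub>v n"
  proof (rule ccontr)
    assume "\<not> ?thesis"
    then have "Re (w $ i) = 0 \<and> Im (w $ i) = 0" if "i < n" for i
      using that w(1) by (metis carrier_vecD index_map_vec(1) index_zero_vec(1) x_def y_def)
    then have "w = 0\<^sub>v n" using w(1) by (intro eq_vecI) (auto simp: complex_eq_iff)
    then show False using w(2) by simp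
  qed
  have "x \<bullet> (H *\<^sub>v y) = (H *\<^sub>v x) \<bullet> y"
    using scalar_prod_transpose[OF H xy(2,1)] sym by simp
  then have "?q * (x \<bullet> x + y \<bullet> y) = 0"
    using xy unfolding Hx Hy
    by (simp add: scalar_prod_add_distrib[of _ n] minus_scalar_prod_distrib[of _ n]
        algebra_simps)
  moreover have "x \<bullet> x + y \<bullet> y \<noteq> 0"
    using nz scalar_prod_self_eq_0_iff[OF xy(1)] scalar_prod_self_eq_0_iff[OF xy(2)]
      scalar_prod_self_ge_0[of x] scalar_prod_self_ge_0[of y] by linarith
  ultimately have q: "?q = 0" by simp
  have "H *\<^sub>v x = ?p \<cdot>\<^sub>v x" "H *\<^sub>v y = ?p \<cdot>\<^sub>v y"
    using xy unfolding Hx Hy q by auto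
  moreover have "ev = complex_of_real ?p" using q by (simp add: complex_eq_iff)
  ultimately show thesis using nz xy that by blast
qed

text \<open>Since \<open>Q\<^sup>T c = c - Z\<^sup>T c\<close>, the Rayleigh quotient of an eigenvector \<open>c\<close> depends on \<open>a = Z\<^sup>T c\<close> alone.\<close>

lemma eigenvalue_bounds:
  fixes Z Q :: "real mat"
  assumes Z: "Z \<in> carrier_mat n n" and Q: "Q \<in> carrier_mat n n" and ZQ: "Z + Q = 1\<^sub>m n"
    and ev: "eigenvalue (cmat (Z * Z\<^sup>T + Q * Q\<^sup>T)) ev"
  shows "ev \<in> complex_of_real ` {1/2 .. (spectral_norm Z)\<^sup>2 + (1 + spectral_norm Z)\<^sup>2}"
proof -
  let ?H = "Z * Z\<^sup>T + Q * Q\<^sup>T"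
  have H: "?H \<in> carrier_mat n n" using Z Q by auto
  have "?H\<^sup>T = ?H" 
    using Z Q by (simp add: transpose_add[of _ n n] transpose_mult[of _ n n _ n])
  then obtain p c where p: "ev = complex_of_real p" and c: "c \<in> carrier_vec n" "c \<noteq> 0\<^sub>v n"
    and Hc: "?H *\<^sub>v c = p \<cdot>\<^sub>v c"
    using eigenvalue_symmetric_real[OF H _ ev] by blast
  define a where "a = Z\<^sup>T *\<^sub>v c"
  have a: "a \<in> carrier_vec n" using Z c by (auto simp: a_def)
  have "Z\<^sup>T + Q\<^sup>T = 1\<^sub>m n" using ZQ Z Q by (metis transpose_add transpose_one)
  then have "a + Q\<^sup>T *\<^sub>v c = c"
    using Z Q c unfolding a_def by (subst add_mult_distrib_mat_vec[symmetric]) auto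
  then have b: "Q\<^sup>T *\<^sub>v c = c - a" using a c Q by (auto simp: vec_eq_iff)
  have e: "c \<bullet> c > 0"
    using scalar_prod_self_eq_0_iff[OF c(1)] c(2) scalar_prod_self_ge_0[of c] by auto
  have "p * (c \<bullet> c) = c \<bullet> (?H *\<^sub>v c)" unfolding Hc using c by simp
  also have "?H *\<^sub>v c = Z *\<^sub>v a + Q *\<^sub>v (Q\<^sup>T *\<^sub>v c)"
    using Z Q c unfolding a_def
    by (simp add: add_mult_distrib_mat_vec[of _ n n] assoc_mult_mat_vec[of _ n n _ n])
  also have "c \<bullet> \<dots> = c \<bullet> (Z *\<^sub>v a) + c \<bullet> (Q *\<^sub>v (c - a))"
    using Z Q c a unfolding b by (simp add: scalar_prod_add_distrib[of _ n])
  also have "\<dots> = a \<bullet> a + (c - a) \<bullet> (c - a)"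
    using scalar_prod_transpose[OF Z a c(1)] scalar_prod_transpose[OF Q _ c(1), of "c - a"] a c b
    by (simp add: a_def)
  finally have ray: "p * (c \<bullet> c) = a \<bullet> a + (c - a) \<bullet> (c - a)" .
  have ca: "(c - a) \<bullet> (c - a) = c \<bullet> c - 2 * (c \<bullet> a) + a \<bullet> a"
    using a c comm_scalar_prod[OF a c(1)]
    by (simp add: minus_scalar_prod_distrib[of _ n] scalar_prod_minus_distrib[of _ n])
  let ?z = "spectral_norm Z" and ?n = "vec_norm2 c"
  (* The parallelogram law: |a|^2 + |c - a|^2 = (|c|^2 + |c - 2a|^2) / 2. *)
  have "(c - a - a) \<bullet> (c - a - a) = c \<bullet> c - 4 * (c \<bullet> a) + 4 * (a \<bullet> a)"
    using a c comm_scalar_prod[OF a c(1)]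
    by (simp add: minus_scalar_prod_distrib[of _ n] scalar_prod_minus_distrib[of _ n])
  then have "(1/2) * (c \<bullet> c) \<le> p * (c \<bullet> c)"
    using scalar_prod_self_ge_0[of "c - a - a"] ray ca by simp
  then have lo: "1/2 \<le> p" using e by (rule mult_right_le_imp_le)
  have az: "vec_norm2 a \<le> ?z * ?n" unfolding a_def by (rule spectral_norm_bound_transpose[OF Z c(1)])
  have "a \<bullet> a \<le> (?z * ?n)\<^sup>2"
    using power_mono[OF az vec_norm2_nonneg, of 2] by (simp add: vec_norm2_square)
  then have aa: "a \<bullet> a \<le> ?z\<^sup>2 * (c \<bullet> c)" by (simp add: power_mult_distrib vec_norm2_square)
  have "- (c \<bullet> a) \<le> ?n * vec_norm2 a" using scalar_prod_le_vec_norm2[OF c(1) a] by linarith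
  also have "\<dots> \<le> ?n * (?z * ?n)" by (intro mult_left_mono az vec_norm2_nonneg)
  also have "\<dots> = ?z * (c \<bullet> c)" by (simp add: vec_norm2_square[symmetric] power2_eq_square)
  finally have "p * (c \<bullet> c) \<le> (?z\<^sup>2 + (1 + ?z)\<^sup>2) * (c \<bullet> c)"
    using ray ca aa by (simp add: power2_eq_square algebra_simps)
  then have "p \<le> ?z\<^sup>2 + (1 + ?z)\<^sup>2" using e by (rule mult_right_le_imp_le)
  then show ?thesis using lo p by auto
qed

section \<open>Characteristic polynomials of low-rank perturbations and block matrices\<close>

text \<open>The hypotheses mention no dimension that has to be guessed, so that this form of associativity
works as a rewrite rule for products of rectangular matrices.\<close>

lemma mult_assoc_dim:
  fixes A B C :: "'a :: semiring_0 mat"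
  assumes "dim_col A = dim_row B" "dim_col B = dim_row C"
  shows "A * B * C = A * (B * C)"
  using assms by (intro assoc_mult_mat[of A _ _ B _ C]) auto

text \<open>The Weinstein-Aronszajn identity, scaled so that it holds over an integral domain. Both sides are
\<open>c\<^sup>m\<close> times the determinant of \<open>[c 1, -N; R, 1]\<close>: eliminating \<open>R\<close> by a column operation leaves
\<open>c 1 + N R\<close> in the upper left corner, and eliminating it by a row operation, after multiplying
the lower block row by \<open>c\<close>, leaves \<open>c 1 + R N\<close> in the lower right corner.\<close>

lemma det_smult_one_plus_mult_commute:
  fixes N R :: "'a :: idom mat"
  assumes N: "N \<in> carrier_mat n m" and R: "R \<in> carrier_mat m n"
  shows "c ^ m * det (c \<cdot>\<^sub>m 1\<^sub>m n + N * R) = c ^ n * det (c \<cdot>\<^sub>m 1\<^sub>m m + R * N)"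
proof -
  let ?F = "four_block_mat (c \<cdot>\<^sub>m 1\<^sub>m n) (- N) R (1\<^sub>m m)"
  have dims: "c \<cdot>\<^sub>m 1\<^sub>m n \<in> carrier_mat n n" "- N \<in> carrier_mat n m" "- R \<in> carrier_mat m n"
    "(0\<^sub>m n m :: 'a mat) \<in> carrier_mat n m" "c \<cdot>\<^sub>m 1\<^sub>m m \<in> carrier_mat m m"
    "(1\<^sub>m n :: 'a mat) \<in> carrier_mat n n" "(1\<^sub>m m :: 'a mat) \<in> carrier_mat m m"
    "c \<cdot>\<^sub>m 1\<^sub>m n + N * R \<in> carrier_mat n n" "c \<cdot>\<^sub>m 1\<^sub>m m + R * N \<in> carrier_mat m m"
    "(0\<^sub>m m n :: 'a mat) \<in> carrier_mat m n"
    using N R by auto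
  have F: "?F \<in> carrier_mat (n + m) (n + m)" by auto
  let ?E1 = "four_block_mat (1\<^sub>m n) (0\<^sub>m n m) (- R) (1\<^sub>m m)"
  let ?E2 = "four_block_mat (1\<^sub>m n) (0\<^sub>m n m) (- R) (c \<cdot>\<^sub>m 1\<^sub>m m)"
  have E: "?E1 \<in> carrier_mat (n + m) (n + m)" "?E2 \<in> carrier_mat (n + m) (n + m)" by auto
  have one: "det ?E1 = 1"
    using det_four_block_mat_upper_right_zero[OF dims(6) refl dims(3) dims(7)] by simp
  have pow: "det ?E2 = c ^ m"
    using det_four_block_mat_upper_right_zero[OF dims(6) refl dims(3) dims(5)] by (simp add: det_smult)
  have "?F * ?E1 = four_block_mat (c \<cdot>\<^sub>m 1\<^sub>m n + N * R) (- N) (0\<^sub>m m n) (1\<^sub>m m)"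
    using N R by (subst mult_four_block_mat[OF dims(1,2) R dims(7) dims(6,4,3,7)]) auto
  then have "det ?F = det (c \<cdot>\<^sub>m 1\<^sub>m n + N * R)"
    using det_mult[OF F E(1)] one det_four_block_mat_lower_left_zero[OF dims(8,2) refl dims(7)] by simp
  moreover have "?E2 * ?F = four_block_mat (c \<cdot>\<^sub>m 1\<^sub>m n) (- N) (0\<^sub>m m n) (c \<cdot>\<^sub>m 1\<^sub>m m + R * N)"
  proof -
    have "- R * (c \<cdot>\<^sub>m 1\<^sub>m n) + c \<cdot>\<^sub>m 1\<^sub>m m * R = 0\<^sub>m m n"
      using R by (auto simp: mult_smult_distrib[of _ m n] mult_smult_assoc_mat[of _ m m])
    moreover have "- R * - N + c \<cdot>\<^sub>m 1\<^sub>m m * 1\<^sub>m m = c \<cdot>\<^sub>m 1\<^sub>m m + R * N"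
      using N R comm_add_mat[OF dims(5), of "R * N"] by simp
    ultimately show ?thesis
      using N R by (subst mult_four_block_mat[OF dims(6,4,3,5) dims(1,2) R dims(7)]) auto
  qed
  then have "c ^ m * det ?F = c ^ n * det (c \<cdot>\<^sub>m 1\<^sub>m m + R * N)"
    using det_mult[OF E(2) F] pow det_four_block_mat_lower_left_zero[OF dims(1,2) refl dims(9)]
    by (simp add: det_smult)
  ultimately show ?thesis by simp
qed

text \<open>Perturbing the identity by a product through dimension \<open>m\<close> destroys at most \<open>m\<close> of the
\<open>n\<close> factors \<open>x - 1\<close>. The power on the right-hand side keeps the statement meaningful for \<open>m > n\<close>.\<close>

lemma char_poly_one_minus_low_rank:
  fixes N R :: "'a :: idom mat"
  assumes N: "N \<in> carrier_mat n m" and R: "R \<in> carrier_mat m n"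
  shows "[:-1, 1:] ^ n dvd [:-1, 1:] ^ m * char_poly (1\<^sub>m n - N * R)"
proof -
  let ?h = "map_mat (\<lambda>a :: 'a. [:a:])"
  have "char_poly_matrix (1\<^sub>m n - N * R) = [:-1, 1:] \<cdot>\<^sub>m 1\<^sub>m n + ?h (N * R)"
    using N R by (intro eq_matI) (auto simp: char_poly_matrix_def one_pCons)
  also have "?h (N * R) = ?h N * ?h R"
    by (rule map_poly_mult(1)[OF N R])
  finally have "[:-1, 1:] ^ m * char_poly (1\<^sub>m n - N * R)
      = [:-1, 1:] ^ m * det ([:-1, 1:] \<cdot>\<^sub>m 1\<^sub>m n + ?h N * ?h R)"
    unfolding char_poly_def by simp
  also have "\<dots> = [:-1, 1:] ^ n * det ([:-1, 1:] \<cdot>\<^sub>m 1\<^sub>m m + ?h R * ?h N)"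
    using N R by (intro det_smult_one_plus_mult_commute) auto
  finally show ?thesis by (rule dvdI)
qed

lemma char_poly_four_block_diag:
  fixes A B :: "'a :: idom mat"
  assumes A: "A \<in> carrier_mat n n" and B: "B \<in> carrier_mat m m"
  shows "char_poly (four_block_mat A (0\<^sub>m n m) (0\<^sub>m m n) B) = char_poly A * char_poly B"
proof -
  have "char_poly_matrix (four_block_mat A (0\<^sub>m n m) (0\<^sub>m m n) B)
      = four_block_mat (char_poly_matrix A) (0\<^sub>m n m) (0\<^sub>m m n) (char_poly_matrix B)"
    using A B by (intro eq_matI) (auto simp: char_poly_matrix_def)
  then show ?thesis
    using A B by (simp add: char_poly_def det_four_block_mat_lower_left_zero[of _ n _ m])
qed

lemma char_poly_one: "char_poly (1\<^sub>m n :: 'a :: comm_ring_1 mat) = [:-1, 1:] ^ n"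
proof -
  have "char_poly_matrix (1\<^sub>m n :: 'a mat) = [:-1, 1:] \<cdot>\<^sub>m 1\<^sub>m n"
    by (intro eq_matI) (auto simp: char_poly_matrix_def one_pCons)
  then show ?thesis by (simp add: char_poly_def det_smult)
qed

text \<open>Here \<open>Z Z\<^sup>T + Q Q\<^sup>T = 1 - (Z Q\<^sup>T + Q Z\<^sup>T)\<close>, because \<open>(Z + Q) (Z + Q)\<^sup>T = 1\<close>. Each of the two mixed
products contains the factorization \<open>Q = N P\<close> once, so their sum is \<open>[Z P\<^sup>T, N] [N\<^sup>T; P Z\<^sup>T]\<close>, a product
through dimension \<open>2 m\<close>.\<close>

lemma char_poly_sum_of_squares_low_rank:
  fixes Z Q N P :: "real mat"
  assumes Z: "Z \<in> carrier_mat n n" and ZQ: "Z + Q = 1\<^sub>m n"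
    and N: "N \<in> carrier_mat n m" and P: "P \<in> carrier_mat m n" and Q: "Q = N * P"
  shows "[:-1, 1:] ^ n dvd [:-1, 1:] ^ (2 * m) * char_poly (Z * Z\<^sup>T + Q * Q\<^sup>T)"
proof -
  have Qc: "Q \<in> carrier_mat n n" using N P Q by auto
  (* Block rows and block columns are block matrices whose other blocks have a zero dimension. *)
  let ?U = "four_block_mat (Z * P\<^sup>T) N (0\<^sub>m 0 m) (0\<^sub>m 0 m)"
  let ?V = "four_block_mat (N\<^sup>T) (0\<^sub>m m 0) (P * Z\<^sup>T) (0\<^sub>m m 0)"
  have "?U * ?V = four_block_mat (Z * Q\<^sup>T + Q * Z\<^sup>T) (0\<^sub>m n 0) (0\<^sub>m 0 n) (0\<^sub>m 0 0)"
    using Z N P unfolding Q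
    by (subst mult_four_block_mat[of _ n m _ m _ 0 _ _ n _ 0])
      (auto simp: mult_assoc_dim transpose_mult[of _ n m _ n])
  also have "\<dots> = Z * Q\<^sup>T + Q * Z\<^sup>T" using Z Qc by (intro eq_matI) auto
  finally have UV: "?U * ?V = Z * Q\<^sup>T + Q * Z\<^sup>T" .
  have "Z\<^sup>T + Q\<^sup>T = 1\<^sub>m n" using ZQ Z Qc by (metis transpose_add transpose_one)
  then have "1\<^sub>m n = (Z + Q) * (Z\<^sup>T + Q\<^sup>T)" using ZQ by simp
  also have "\<dots> = (Z * Z\<^sup>T + Q * Z\<^sup>T) + (Z * Q\<^sup>T + Q * Q\<^sup>T)"
    using Z Qc by (simp add: add_mult_distrib_mat[of _ n n] mult_add_distrib_mat[of _ n n _ n])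
  finally have "1\<^sub>m n = (Z * Z\<^sup>T + Q * Z\<^sup>T) + (Z * Q\<^sup>T + Q * Q\<^sup>T)" .
  then have "Z * Z\<^sup>T + Q * Q\<^sup>T = 1\<^sub>m n - ?U * ?V"
    unfolding UV using Z Qc by (intro eq_matI) (simp_all del: index_one_mat(1) index_mult_mat(1))
  moreover have "?U \<in> carrier_mat n (2 * m)" "?V \<in> carrier_mat (2 * m) n" using Z N P by auto
  ultimately show ?thesis using char_poly_one_minus_low_rank[of ?U n "2 * m" ?V] by simp
qed

section \<open>Preconditioning by an indefinite factorization\<close>

lemma minv_eqI:
  assumes A: "(A :: 'a :: field mat) \<in> carrier_mat n n" and B: "B \<in> carrier_mat n n"
    and AB: "A * B = 1\<^sub>m n"
  shows "minv A = B"
proof -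
  have BA: "B * A = 1\<^sub>m n" by (rule mat_mult_left_right_inverse[OF A B AB])
  have "invertible_mat A" unfolding invertible_mat_def inverts_mat_def using A B AB BA by auto
  note i = minv_inverse[OF A this]
  have "minv A = minv A * (A * B)" using AB i A by simp
  also have "\<dots> = B" using i A B by (simp add: assoc_mult_mat[of _ n n _ n _ n, symmetric])
  finally show ?thesis .
qed

lemma det_nonzero_inverse:
  assumes A: "(A :: 'a :: field mat) \<in> carrier_mat n n" and "det A \<noteq> 0"
  shows "minv A \<in> carrier_mat n n" "A * minv A = 1\<^sub>m n" "minv A * A = 1\<^sub>m n"
proof -
  have "A \<in> Units (ring_mat TYPE('a) n ())" using det_non_zero_imp_unit[OF assms] .
  then obtain B where "B \<in> carrier_mat n n" "A * B = 1\<^sub>m n" "B * A = 1\<^sub>m n"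
    unfolding Units_def ring_mat_def by auto
  then have "invertible_mat A" unfolding invertible_mat_def inverts_mat_def using A by auto
  from minv_inverse[OF A this]
  show "minv A \<in> carrier_mat n n" "A * minv A = 1\<^sub>m n" "minv A * A = 1\<^sub>m n" .
qed

lemma det_nonzero_if_right_inverse:
  assumes "(A :: 'a :: field mat) \<in> carrier_mat n n" "B \<in> carrier_mat n n" "A * B = 1\<^sub>m n"
  shows "det A \<noteq> 0"
  using det_mult[OF assms(1,2)] assms(3) by auto

text \<open>The preconditioned matrix is \<open>E2\<inverse> X E2\<close>, hence similar to \<open>X\<close>. Stating this for outer factors
\<open>E1\<close> and \<open>E2\<close> allows a factorization \<open>F R\<close> of the approximate Schur complement to be split between
the two sides.\<close>

lemma char_poly_minv_mult_common_factors:
  fixes E1 E2 X :: "'a :: field mat"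
  assumes E1: "E1 \<in> carrier_mat n n" "det E1 \<noteq> 0" and E2: "E2 \<in> carrier_mat n n" "det E2 \<noteq> 0"
    and X: "X \<in> carrier_mat n n"
  shows "minv (E1 * E2) * (E1 * X * E2) \<in> carrier_mat n n"
    and "char_poly (minv (E1 * E2) * (E1 * X * E2)) = char_poly X"
proof -
  note i1 = det_nonzero_inverse[OF E1] and i2 = det_nonzero_inverse[OF E2]
  have c1: "minv E1 * (E1 * Y) = Y" if "Y \<in> carrier_mat n n" for Y
    using that i1 E1 by (simp add: assoc_mult_mat[of _ n n _ n _ n, symmetric])
  have c2: "E2 * (minv E2 * Y) = Y" if "Y \<in> carrier_mat n n" for Y
    using that i2 E2 by (simp add: assoc_mult_mat[of _ n n _ n _ n, symmetric])
  have "minv (E1 * E2) = minv E2 * minv E1"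
    by (rule minv_eqI[of _ n])
      (use E1 E2 i1 i2 c2 in \<open>simp_all add: assoc_mult_mat[of _ n n _ n _ n]\<close>)
  then have "minv (E1 * E2) * (E1 * X * E2) = minv E2 * X * E2"
    using E1 E2 i1 i2 c1 X by (simp add: assoc_mult_mat[of _ n n _ n _ n])
  moreover have "minv E2 * X * E2 \<in> carrier_mat n n" using E2 i2 X by simp
  ultimately show "minv (E1 * E2) * (E1 * X * E2) \<in> carrier_mat n n"
    and "char_poly (minv (E1 * E2) * (E1 * X * E2)) = char_poly X"
    using E2 i2 X by (simp, intro char_poly_similar similar_matI[of _ _ "minv E2" E2 n]) auto
qed

lemma indefinite_factorization_product:
  fixes K Ki B S :: "'a :: comm_ring_1 mat"
  assumes K: "K \<in> carrier_mat k k" and Ki: "Ki \<in> carrier_mat k k"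
    and inv: "K * Ki = 1\<^sub>m k" "Ki * K = 1\<^sub>m k"
    and B: "B \<in> carrier_mat m k" and S: "S \<in> carrier_mat m m"
  shows "four_block_mat (1\<^sub>m k) (0\<^sub>m k m) (B * Ki) (1\<^sub>m m)
       * four_block_mat K (0\<^sub>m k m) (0\<^sub>m m k) (- S)
       * four_block_mat (1\<^sub>m k) (Ki * B\<^sup>T) (0\<^sub>m m k) (1\<^sub>m m)
       = four_block_mat K B\<^sup>T B (B * Ki * B\<^sup>T - S)"
proof -
  have 1: "four_block_mat (1\<^sub>m k) (0\<^sub>m k m) (B * Ki) (1\<^sub>m m)
       * four_block_mat K (0\<^sub>m k m) (0\<^sub>m m k) (- S) = four_block_mat K (0\<^sub>m k m) B (- S)"
    using assms by (subst mult_four_block_mat[of _ k k _ m _ m _ _ k _ m]) (auto simp: mult_assoc_dim)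
  have KB: "K * (Ki * B\<^sup>T) = B\<^sup>T"
    using assms by (simp add: mult_assoc_dim[symmetric])
  have "B * Ki * B\<^sup>T + - S = B * Ki * B\<^sup>T - S"
    using assms by (intro eq_matI) auto
  then show ?thesis
    unfolding 1 using assms KB
    by (subst mult_four_block_mat[of _ k k _ m _ m _ _ k _ m]) (auto simp: mult_assoc_dim)
qed

text \<open>\<open>F R\<close> is the approximate and \<open>F H R\<close> the true Schur complement. Both block matrices have the outer
factors \<open>[K, 0; B, -F]\<close> and \<open>[1, K\<inverse> B\<^sup>T; 0, R]\<close>; between them stands the identity for the
preconditioner and \<open>diag(1, H)\<close> for the system matrix.\<close>

lemma char_poly_indefinite_preconditioned:
  fixes K Ki B F R H :: "'a :: field mat"
  assumes K: "K \<in> carrier_mat k k" and Ki: "Ki \<in> carrier_mat k k"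
    and inv: "K * Ki = 1\<^sub>m k" "Ki * K = 1\<^sub>m k"
    and B: "B \<in> carrier_mat m k"
    and F: "F \<in> carrier_mat m m" "det F \<noteq> 0" and R: "R \<in> carrier_mat m m" "det R \<noteq> 0"
    and H: "H \<in> carrier_mat m m"
  defines "T \<equiv> minv (four_block_mat K B\<^sup>T B (B * Ki * B\<^sup>T - F * R))
      * four_block_mat K B\<^sup>T B (B * Ki * B\<^sup>T - F * H * R)"
  shows "T \<in> carrier_mat (k + m) (k + m)" and "char_poly T = [:-1, 1:] ^ k * char_poly H"
proof -
  let ?E1 = "four_block_mat K (0\<^sub>m k m) B (- F)"
  let ?E2 = "four_block_mat (1\<^sub>m k) (Ki * B\<^sup>T) (0\<^sub>m m k) R"
  let ?X = "four_block_mat (1\<^sub>m k) (0\<^sub>m k m) (0\<^sub>m m k) H"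
  have E1: "?E1 \<in> carrier_mat (k + m) (k + m)" and E2: "?E2 \<in> carrier_mat (k + m) (k + m)"
    and X: "?X \<in> carrier_mat (k + m) (k + m)" using K F R H by auto
  have "- F = (-1) \<cdot>\<^sub>m F" using F by (intro eq_matI) auto
  then have "det (- F) \<noteq> 0" using F by (simp add: det_smult)
  moreover have "det K \<noteq> 0" by (rule det_nonzero_if_right_inverse[OF K Ki inv(1)])
  moreover have "det ?E1 = det K * det (- F)"
    using F by (intro det_four_block_mat_upper_right_zero[OF K refl B]) auto
  ultimately have d1: "det ?E1 \<noteq> 0" by simp
  have "det ?E2 = det R"
    using det_four_block_mat_lower_left_zero[of "1\<^sub>m k" k "Ki * B\<^sup>T" m "0\<^sub>m m k" R] Ki B R by simp
  then have d2: "det ?E2 \<noteq> 0" using R by simp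
  have KB: "K * (Ki * B\<^sup>T) = B\<^sup>T"
    using K Ki inv B by (simp add: mult_assoc_dim[symmetric])
  have prod: "four_block_mat K (0\<^sub>m k m) B (- Y) * ?E2 = four_block_mat K B\<^sup>T B (B * Ki * B\<^sup>T - Y * R)"
    if Y: "Y \<in> carrier_mat m m" for Y
  proof -
    have "B * Ki * B\<^sup>T + - (Y * R) = B * Ki * B\<^sup>T - Y * R"
      using K Ki B Y R by (intro eq_matI) auto
    then show ?thesis
      using K Ki B Y R KB
      by (subst mult_four_block_mat[of _ k k _ m _ m _ _ k _ m]) (auto simp: mult_assoc_dim)
  qed
  have "?E1 * ?X = four_block_mat K (0\<^sub>m k m) B (- (F * H))"
    using K B F H by (subst mult_four_block_mat[of _ k k _ m _ m _ _ k _ m]) auto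
  then have "?E1 * ?X * ?E2 = four_block_mat K B\<^sup>T B (B * Ki * B\<^sup>T - F * H * R)"
    using prod[of "F * H"] F H by simp
  moreover have "?E1 * ?E2 = four_block_mat K B\<^sup>T B (B * Ki * B\<^sup>T - F * R)"
    using prod F by simp
  ultimately have T: "T = minv (?E1 * ?E2) * (?E1 * ?X * ?E2)" unfolding T_def by simp
  show "T \<in> carrier_mat (k + m) (k + m)"
    unfolding T by (rule char_poly_minv_mult_common_factors(1)[OF E1 d1 E2 d2 X])
  have "char_poly ?X = [:-1, 1:] ^ k * char_poly H"
    using char_poly_four_block_diag[of "1\<^sub>m k" k H m] H by (simp add: char_poly_one)
  then show "char_poly T = [:-1, 1:] ^ k * char_poly H"
    unfolding T char_poly_minv_mult_common_factors(2)[OF E1 d1 E2 d2 X] .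
qed

section \<open>Passing to the complex spectrum\<close>

lemma char_poly_cmat_factor:
  assumes X: "X \<in> carrier_mat N N" and H: "H \<in> carrier_mat n n"
    and f: "char_poly X = [:-1, 1:] ^ k * char_poly H"
  shows "char_poly (cmat X) = [:-1, 1:] ^ k * char_poly (cmat H)"
proof -
  interpret map_poly_comm_ring_hom complex_of_real by unfold_locales
  have "char_poly (cmat X) = map_poly complex_of_real ([:-1, 1:] ^ k * char_poly H)"
    unfolding of_real_hom.char_poly_hom[OF X] f ..
  then show ?thesis by (simp add: hom_distribs of_real_hom.char_poly_hom[OF H])
qed

lemma eigenvalue_cmat_factor:
  assumes X: "X \<in> carrier_mat N N" and H: "H \<in> carrier_mat n n"
    and f: "char_poly X = [:-1, 1:] ^ k * char_poly H"
    and ev: "eigenvalue (cmat X) ev"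
  shows "ev = 1 \<or> eigenvalue (cmat H) ev"
proof -
  have "poly (char_poly (cmat X)) ev = 0"
    using ev X eigenvalue_root_char_poly[of "cmat X" N ev] by auto
  then show ?thesis
    using H eigenvalue_root_char_poly[of "cmat H" n ev]
    by (auto simp: char_poly_cmat_factor[OF X H f])
qed

text \<open>Comparing orders at \<open>1\<close>: a divisibility with \<open>x - 1\<close> on both sides is what the low-rank argument
delivers, and it turns into an inequality of multiplicities free of truncated subtraction.\<close>

lemma alg_mult_one_cmat_factor:
  assumes X: "X \<in> carrier_mat N N" and H: "H \<in> carrier_mat n n"
    and f: "char_poly X = [:-1, 1:] ^ k * char_poly H"
    and dv: "[:-1, 1:] ^ n dvd [:-1, 1:] ^ m * char_poly H"
  shows "k + n \<le> m + alg_mult (cmat X) 1"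
proof -
  interpret map_poly_comm_ring_hom complex_of_real by unfold_locales
  let ?l = "[:-1, 1:] :: complex poly"
  have "map_poly complex_of_real ([:-1, 1:] ^ n) dvd
      map_poly complex_of_real ([:-1, 1:] ^ m * char_poly H)"
    by (rule hom_dvd[OF dv])
  then have "?l ^ n dvd ?l ^ m * char_poly (cmat H)"
    by (simp add: hom_distribs of_real_hom.char_poly_hom[OF H])
  then have "?l ^ k * ?l ^ n dvd ?l ^ k * (?l ^ m * char_poly (cmat H))"
    by (rule mult_dvd_mono[OF dvd_refl])
  then have dvd: "?l ^ (k + n) dvd ?l ^ m * char_poly (cmat X)"
    by (simp add: char_poly_cmat_factor[OF X H f] power_add mult.left_commute)
  have nz: "char_poly (cmat X) \<noteq> 0"
    using degree_monic_char_poly[of "cmat X" N] X by auto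
  have "k + n \<le> order 1 (?l ^ m * char_poly (cmat X))"
    using dvd nz by (subst (asm) order_divides) (auto)
  also have "\<dots> = m + alg_mult (cmat X) 1"
    using nz order_power_n_n[of "1 :: complex" m] by (simp add: order_mult alg_mult_def)
  finally show ?thesis .
qed

section \<open>Diagonal and selection matrices\<close>

lemma smult_mat_uminus: "(c :: real) \<cdot>\<^sub>m (- B) = - (c \<cdot>\<^sub>m B)"
  by (rule eq_matI) auto

lemma smult_mat_transpose: "(c \<cdot>\<^sub>m B)\<^sup>T = c \<cdot>\<^sub>m B\<^sup>T"
  by (rule eq_matI) auto

lemma smult_smult_mat: "c \<cdot>\<^sub>m (e \<cdot>\<^sub>m B) = (c * e :: real) \<cdot>\<^sub>m B"
  by (rule eq_matI) auto

lemma mat_diag_cong: "(\<And>i. i < n \<Longrightarrow> f i = g i) \<Longrightarrow> mat_diag n f = mat_diag n g"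
  by (intro eq_matI) (auto simp: mat_diag_def)

lemma mat_diag_transpose: "(mat_diag n f)\<^sup>T = mat_diag n f"
  by (intro eq_matI) (auto simp: mat_diag_def)

lemma P_mat_mult_transpose:
  assumes C: "C \<subseteq> {..<n}"
  shows "P_mat n C * (P_mat n C)\<^sup>T = 1\<^sub>m (card C)"
proof (rule eq_matI)
  note car = P_mat_carrier[OF C]
  fix i j assume "i < dim_row (1\<^sub>m (card C))" "j < dim_col (1\<^sub>m (card C))"
  then have ij: "i < card C" "j < card C" by auto
  have inj: "pick C i = pick C j \<longleftrightarrow> i = j"
    using pick_mono_le[of i C j] pick_mono_le[of j C i] ij by (metis nat_neq_iff)
  have "(P_mat n C * (P_mat n C)\<^sup>T) $$ (i, j)
      = (\<Sum>k = 0..<n. P_mat n C $$ (i, k) * P_mat n C $$ (j, k))"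
    using car ij by (simp add: scalar_prod_def)
  also have "\<dots> = (\<Sum>k = 0..<n. if k = pick C i then (if i = j then 1 else 0) else 0)"
    using ij inj by (intro sum.cong) (auto simp: P_mat_index[OF C])
  also have "\<dots> = 1\<^sub>m (card C) $$ (i, j)" using ij pick_card(2)[OF C ij(1)] by simp
  finally show "(P_mat n C * (P_mat n C)\<^sup>T) $$ (i, j) = 1\<^sub>m (card C) $$ (i, j)" .
qed (use P_mat_carrier[OF C] in auto)

section \<open>The two Schur complements\<close>

text \<open>With \<open>G = W s\<inverse>\<close> the products telescope to \<open>G Z = X s\<inverse>\<close> and \<open>G Q = Y s\<inverse>\<close>, so the congruence by
\<open>G\<close> carries the two Gram matrices of \<open>Z\<close> and \<open>Q\<close> to those of \<open>X s\<inverse>\<close> and \<open>Y s\<inverse>\<close>. In the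
application \<open>s = M\<^sup>1\<^sup>/\<^sup>2\<close>, and the right-hand side is \<open>\<alpha>\<close> times the Schur complement of the reduced system.\<close>

lemma schur_complement_congruence:
  fixes X Y s si Wi :: "real mat"
  assumes X: "X \<in> carrier_mat n n" and Y: "Y \<in> carrier_mat n n"
    and s: "s \<in> carrier_mat n n" and si: "si \<in> carrier_mat n n" "si\<^sup>T = si"
    and Wi: "Wi \<in> carrier_mat n n"
    and ssi: "s * si = 1\<^sub>m n" "si * s = 1\<^sub>m n"
    and W: "(X + Y) * Wi = 1\<^sub>m n" "Wi * (X + Y) = 1\<^sub>m n"
  defines "Z \<equiv> s * Wi * X * si" and "Q \<equiv> s * Wi * Y * si" and "G \<equiv> (X + Y) * si"
  shows "Z + Q = 1\<^sub>m n"
    and "G * (Z * Z\<^sup>T + Q * Q\<^sup>T) * G\<^sup>T = X * (si * si) * X\<^sup>T + Y * (si * si) * Y\<^sup>T"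
proof -
  have dims [simp]: "dim_row X = n" "dim_col X = n" "dim_row Y = n" "dim_col Y = n"
    "dim_row s = n" "dim_col s = n" "dim_row si = n" "dim_col si = n"
    "dim_row Wi = n" "dim_col Wi = n"
    using X Y s si Wi by auto
  have c1: "si * (s * V) = V" if "V \<in> carrier_mat n n" for V
    using that by (subst mult_assoc_dim[symmetric]) (auto simp: ssi)
  have c2: "(X + Y) * (Wi * V) = V" if "V \<in> carrier_mat n n" for V
    using that by (subst mult_assoc_dim[symmetric]) (auto simp: W)
  have c3: "Wi * ((X + Y) * V) = V" if "V \<in> carrier_mat n n" for V
    using that by (subst mult_assoc_dim[symmetric]) (auto simp: W)
  have "Z + Q = s * (Wi * ((X + Y) * si))"
    unfolding Z_def Q_def using X Y s si(1) Wi
    by (simp add: mult_assoc_dim add_mult_distrib_mat[of _ n n] mult_add_distrib_mat[of _ n n _ n])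
  also have "\<dots> = 1\<^sub>m n" using c3[OF si(1)] ssi by simp
  finally show "Z + Q = 1\<^sub>m n" .
  have GZ: "G * Z = X * si" and GQ: "G * Q = Y * si"
    unfolding G_def Z_def Q_def using X Y s si(1) Wi by (simp_all add: mult_assoc_dim c1 c2)
  have car: "Z \<in> carrier_mat n n" "Q \<in> carrier_mat n n" "G \<in> carrier_mat n n"
    unfolding Z_def Q_def G_def carrier_mat_def by simp_all
  have "G * (Z * Z\<^sup>T + Q * Q\<^sup>T) * G\<^sup>T = (G * Z) * (G * Z)\<^sup>T + (G * Q) * (G * Q)\<^sup>T"
  proof -
    have "G * (Z * Z\<^sup>T + Q * Q\<^sup>T) * G\<^sup>T = (G * (Z * Z\<^sup>T) + G * (Q * Q\<^sup>T)) * G\<^sup>T"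
      using car by (subst mult_add_distrib_mat[of _ n n _ n]) auto
    also have "\<dots> = G * (Z * Z\<^sup>T) * G\<^sup>T + G * (Q * Q\<^sup>T) * G\<^sup>T"
      using car by (intro add_mult_distrib_mat[of _ n n _ _ n]) auto
    finally show ?thesis using car by (simp add: mult_assoc_dim transpose_mult[of _ n n _ n])
  qed
  also have "\<dots> = X * (si * si) * X\<^sup>T + Y * (si * si) * Y\<^sup>T"
    unfolding GZ GQ using X Y si by (simp add: mult_assoc_dim transpose_mult[of _ n n _ n])
  finally show "G * (Z * Z\<^sup>T + Q * Q\<^sup>T) * G\<^sup>T = X * (si * si) * X\<^sup>T + Y * (si * si) * Y\<^sup>T" .
qed

text \<open>The data common to the reduced and the augmented system. Inside, the nonsingular matrix
\<open>sqrt \<alpha> L + Mb \<Pi>\<^sub>I\<close> is written as \<open>X + Y\<close>.\<close>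

locale optimality_system =
  fixes n :: nat and L Mb M :: "real mat" and I A :: "nat set" and \<alpha> :: real
  assumes L: "L \<in> carrier_mat n n" and Mb: "Mb \<in> carrier_mat n n" and M: "M \<in> carrier_mat n n"
    and M_diagonal: "diagonal_mat M" and M_pos: "\<forall>i<n. M $$ (i, i) > 0"
    and I: "I \<subseteq> {..<n}" and A_eq: "A = {..<n} - I" and \<alpha>_pos: "\<alpha> > 0"
    and W_invertible: "invertible_mat (sqrt \<alpha> \<cdot>\<^sub>m L + Mb * Pi_mat n I)"
begin

abbreviation a :: nat where "a \<equiv> card A"
abbreviation Mi :: "real mat" where "Mi \<equiv> minv M"
abbreviation Ms :: "real mat" where "Ms \<equiv> diag_powr M (1/2)"
abbreviation Msi :: "real mat" where "Msi \<equiv> diag_powr M (- 1/2)"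
abbreviation PiI :: "real mat" where "PiI \<equiv> Pi_mat n I"
abbreviation PiA :: "real mat" where "PiA \<equiv> Pi_mat n A"
abbreviation PI :: "real mat" where "PI \<equiv> P_mat n I"
abbreviation PA :: "real mat" where "PA \<equiv> P_mat n A"
abbreviation X :: "real mat" where "X \<equiv> sqrt \<alpha> \<cdot>\<^sub>m L"
abbreviation Y :: "real mat" where "Y \<equiv> Mb * PiI"

text \<open>\<open>Z\<close> is the matrix whose spectral norm is \<open>\<zeta>\<close>. The pair \<open>G\<close>, \<open>H\<close> is chosen so that \<open>G G\<^sup>T\<close> and
\<open>G H G\<^sup>T\<close> are \<open>\<alpha>\<close> times the approximate and the true Schur complement of the reduced system.\<close>

definition Z :: "real mat" where "Z = Ms * minv (X + Y) * X * Msi"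
definition Q :: "real mat" where "Q = Ms * minv (X + Y) * Y * Msi"
definition H :: "real mat" where "H = Z * Z\<^sup>T + Q * Q\<^sup>T"
definition G :: "real mat" where "G = (X + Y) * Msi"

lemma A: "A \<subseteq> {..<n}" using A_eq by auto

lemma M_mat_diag: "M = mat_diag n (\<lambda>i. M $$ (i, i))"
  using M M_diagonal by (intro eq_matI) (auto simp: mat_diag_def diagonal_mat_def)

lemma diag_powr_mat_diag: "diag_powr M p = mat_diag n (\<lambda>i. M $$ (i, i) powr p)"
  using M by (simp add: diag_powr_def)

lemma M_mult_diag: "M * mat_diag n (\<lambda>i. 1 / M $$ (i, i)) = 1\<^sub>m n"
  using M_pos by (subst M_mat_diag, unfold mat_diag_diag mat_diag_one[symmetric])
    (rule mat_diag_cong, force)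

lemma Mi_mat_diag: "Mi = mat_diag n (\<lambda>i. 1 / M $$ (i, i))"
  by (rule minv_eqI[OF M mat_diag_dim M_mult_diag])

lemmas mat_diags = diag_powr_mat_diag Mi_mat_diag Pi_mat_def mat_diag_diag mat_diag_transpose

lemma dims [simp]:
  "dim_row L = n" "dim_col L = n" "dim_row Mb = n" "dim_col Mb = n" "dim_row M = n" "dim_col M = n"
  "dim_row Mi = n" "dim_col Mi = n" "dim_row (diag_powr M p) = n" "dim_col (diag_powr M p) = n"
  "dim_row (Pi_mat n C) = n" "dim_col (Pi_mat n C) = n"
  "dim_row PA = a" "dim_col PA = n" "dim_row PI = card I" "dim_col PI = n"
  using L Mb M P_mat_carrier[OF A] P_mat_carrier[OF I]
  by (auto simp: mat_diags mat_diag_def)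

lemma carriers [simp]:
  "Mi \<in> carrier_mat n n" "diag_powr M p \<in> carrier_mat n n" "Pi_mat n C \<in> carrier_mat n n"
  "PA \<in> carrier_mat a n" "PI \<in> carrier_mat (card I) n"
  by (rule carrier_matI; rule dims)+

lemma M_Mi: "M * Mi = 1\<^sub>m n"
  unfolding Mi_mat_diag by (rule M_mult_diag)

lemma Mi_M: "Mi * M = 1\<^sub>m n"
  by (rule mat_mult_left_right_inverse[OF M carriers(1) M_Mi])

lemma Ms_Msi: "Ms * Msi = 1\<^sub>m n" "Msi * Ms = 1\<^sub>m n" and Msi_Msi: "Msi * Msi = Mi"
proof -
  show "Ms * Msi = 1\<^sub>m n" "Msi * Ms = 1\<^sub>m n"
    using M_pos unfolding mat_diags mat_diag_one[symmetric]
    by (intro mat_diag_cong; force simp: powr_add[symmetric])+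
  show "Msi * Msi = Mi"
    using M_pos unfolding mat_diags
    by (intro mat_diag_cong) (force simp: powr_add[symmetric] powr_minus_divide)
qed

lemma X_Y_carrier: "X \<in> carrier_mat n n" "Y \<in> carrier_mat n n" "X + Y \<in> carrier_mat n n"
  by (rule carrier_matI; simp)+

lemmas W_inv = minv_inverse[OF X_Y_carrier(3) W_invertible]

lemmas W_inv_dims [simp] = carrier_matD[OF W_inv(1)]

lemma Z_Q_H_G_carrier: "Z \<in> carrier_mat n n" "Q \<in> carrier_mat n n" "H \<in> carrier_mat n n" "G \<in> carrier_mat n n"
  unfolding Z_def Q_def H_def G_def by (rule carrier_matI; simp)+

lemma transpose_diag_powr [simp]: "(diag_powr M p)\<^sup>T = diag_powr M p" by (simp add: mat_diags)

lemma Z_plus_Q: "Z + Q = 1\<^sub>m n"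
  unfolding Z_def Q_def
  by (rule schur_complement_congruence(1)[OF X_Y_carrier(1,2) _ _ _ W_inv(1) Ms_Msi W_inv(2,3)])
    (simp_all add: transpose_diag_powr)

lemma zeta_eq: "zeta n \<alpha> M L Mb I = spectral_norm Z"
  by (simp add: zeta_def Z_def)

text \<open>The cross terms of \<open>(X + Y) M\<inverse> (X + Y)\<^sup>T\<close> are absent here: this is what distinguishes the true Schur
complement from its approximation \<open>G G\<^sup>T\<close>. The second summand uses that \<open>\<Pi>\<^sub>I\<close> is idempotent and
commutes with \<open>M\<inverse>\<close>.\<close>

lemma G_H_G: "G * H * G\<^sup>T = \<alpha> \<cdot>\<^sub>m (L * Mi * L\<^sup>T) + Mb * Mi * PiI * Mb\<^sup>T"
proof -
  have "G * H * G\<^sup>T = X * Mi * X\<^sup>T + Y * Mi * Y\<^sup>T"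
    unfolding G_def H_def Z_def Q_def Msi_Msi[symmetric]
    by (rule schur_complement_congruence(2)[OF X_Y_carrier(1,2) _ _ _ W_inv(1) Ms_Msi W_inv(2,3)])
      (simp_all add: transpose_diag_powr)
  also have "X * Mi * X\<^sup>T = \<alpha> \<cdot>\<^sub>m (L * Mi * L\<^sup>T)"
    using \<alpha>_pos L
    by (simp add: smult_mat_transpose mult_smult_distrib[of _ n n _ n]
        mult_smult_assoc_mat[of _ n n _ n] mult_assoc_dim smult_smult_mat)
  also have "Y * Mi * Y\<^sup>T = Mb * (PiI * Mi * PiI\<^sup>T) * Mb\<^sup>T"
    by (simp add: transpose_mult[of _ n n _ n] Mb mult_assoc_dim)
  also have "PiI * Mi * PiI\<^sup>T = Mi * PiI"
    unfolding mat_diags by (intro mat_diag_cong) simp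
  finally show ?thesis by (simp add: mult_assoc_dim)
qed

lemma S_red_hat_eq: "S_red_hat n \<alpha> M L Mb I = G * G\<^sup>T"
  unfolding S_red_hat_def G_def
  using X_Y_carrier by (simp add: transpose_mult[of _ n n _ n] transpose_diag_powr mult_assoc_dim Msi_Msi[symmetric])

lemma det_G: "det G \<noteq> 0"
proof -
  have "det (X + Y) \<noteq> 0" "det Msi \<noteq> 0"
    using det_nonzero_if_right_inverse[OF X_Y_carrier(3) W_inv(1,2)]
      det_nonzero_if_right_inverse[of Msi n Ms] Ms_Msi by simp_all
  then show ?thesis unfolding G_def using X_Y_carrier by (simp add: det_mult[of _ n])
qed

lemma eigenvalue_H:
  assumes "eigenvalue (cmat H) ev"
  shows "ev \<in> complex_of_real ` {1/2 .. (zeta n \<alpha> M L Mb I)\<^sup>2 + (1 + zeta n \<alpha> M L Mb I)\<^sup>2}"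
  using eigenvalue_bounds[OF Z_Q_H_G_carrier(1,2) Z_plus_Q] assms unfolding zeta_eq H_def by blast

text \<open>\<open>\<Pi>\<^sub>I\<close> commutes with the diagonal matrix \<open>M\<^sup>-\<^sup>1\<^sup>/\<^sup>2\<close>, so it can be moved to the right end of \<open>Q\<close> and split
there as \<open>P\<^sub>I\<^sup>T P\<^sub>I\<close>; this exhibits \<open>Q\<close> as a product through dimension \<open>|I|\<close>.\<close>

lemma H_multiplicity: "[:-1, 1:] ^ n dvd [:-1, 1:] ^ (2 * card I) * char_poly H"
proof -
  have "PiI * Msi = Msi * PiI"
    unfolding mat_diags by (intro mat_diag_cong) simp
  also have "\<dots> = Msi * PI\<^sup>T * PI"
    by (simp add: P_mat_transpose_mult[OF I, symmetric] mult_assoc_dim)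
  finally have "Q = (Ms * minv (X + Y) * Mb * Msi * PI\<^sup>T) * PI"
    using W_inv(1) by (simp add: Q_def mult_assoc_dim)
  then show ?thesis
    unfolding H_def
    by (intro char_poly_sum_of_squares_low_rank[OF Z_Q_H_G_carrier(1) Z_plus_Q]) (auto intro!: carrier_matI)
qed

lemma spectrum_from_H:
  assumes T: "T \<in> carrier_mat N N" and f: "char_poly T = [:-1, 1:] ^ k * char_poly H"
    and \<zeta>: "\<zeta> = zeta n \<alpha> M L Mb I"
  shows "(\<forall>ev. eigenvalue (cmat T) ev \<longrightarrow>
            ev \<in> complex_of_real ` ({1} \<union> {1/2 .. \<zeta>\<^sup>2 + (1 + \<zeta>)\<^sup>2}))
         \<and> int (alg_mult (cmat T) 1) \<ge> int k + int n - 2 * int (card I)"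
proof (intro conjI allI impI)
  fix ev assume "eigenvalue (cmat T) ev"
  then show "ev \<in> complex_of_real ` ({1} \<union> {1/2 .. \<zeta>\<^sup>2 + (1 + \<zeta>)\<^sup>2})"
    using eigenvalue_cmat_factor[OF T Z_Q_H_G_carrier(3) f] eigenvalue_H[of ev] unfolding \<zeta> by auto
next
  show "int (alg_mult (cmat T) 1) \<ge> int k + int n - 2 * int (card I)"
    using alg_mult_one_cmat_factor[OF T Z_Q_H_G_carrier(3) f H_multiplicity] by linarith
qed

subsection \<open>The reduced system\<close>

lemma IPF_red_eq:
  "IPF_red n \<alpha> M L Mb I
     = four_block_mat M L\<^sup>T L (L * Mi * L\<^sup>T - ((1 / \<alpha>) \<cdot>\<^sub>m G) * G\<^sup>T)"
  unfolding IPF_red_def S_red_hat_eq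
  using indefinite_factorization_product[OF M _ M_Mi Mi_M L, of "(1 / \<alpha>) \<cdot>\<^sub>m (G * G\<^sup>T)"] Z_Q_H_G_carrier(4)
  by (simp add: mult_smult_assoc_mat[of _ n n _ n])

lemma J_red_eq:
  "J_red n \<alpha> M L Mb I
     = four_block_mat M L\<^sup>T L (L * Mi * L\<^sup>T - ((1 / \<alpha>) \<cdot>\<^sub>m G) * H * G\<^sup>T)"
proof -
  have "((1 / \<alpha>) \<cdot>\<^sub>m G) * H * G\<^sup>T = (1 / \<alpha>) \<cdot>\<^sub>m (G * H * G\<^sup>T)"
    using Z_Q_H_G_carrier by (simp add: mult_smult_assoc_mat[of _ n n _ n])
  also have "L * Mi * L\<^sup>T - \<dots> = - ((1 / \<alpha>) \<cdot>\<^sub>m (Mb * Mi * PiI * Mb\<^sup>T))"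
    using \<alpha>_pos unfolding G_H_G
    by (intro eq_matI) (simp_all del: index_mult_mat(1) add: algebra_simps)
  finally show ?thesis by (simp add: J_red_def)
qed

lemma char_poly_reduced:
  defines "T \<equiv> minv (IPF_red n \<alpha> M L Mb I) * J_red n \<alpha> M L Mb I"
  shows "T \<in> carrier_mat (n + n) (n + n)" and "char_poly T = [:-1, 1:] ^ n * char_poly H"
proof -
  have F: "(1 / \<alpha>) \<cdot>\<^sub>m G \<in> carrier_mat n n" "det ((1 / \<alpha>) \<cdot>\<^sub>m G) \<noteq> 0"
    and R: "G\<^sup>T \<in> carrier_mat n n" "det (G\<^sup>T) \<noteq> 0"
    using det_G \<alpha>_pos Z_Q_H_G_carrier(4) by (simp_all add: det_smult det_transpose)
  show "T \<in> carrier_mat (n + n) (n + n)" and "char_poly T = [:-1, 1:] ^ n * char_poly H"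
    unfolding T_def IPF_red_eq J_red_eq
    by (rule char_poly_indefinite_preconditioned[OF M carriers(1) M_Mi Mi_M L F R Z_Q_H_G_carrier(3)])+
qed

subsection \<open>The augmented system\<close>

lemma PA_simps: "PA * PA\<^sup>T = 1\<^sub>m a" "PA\<^sup>T * PA = PiA"
  by (rule P_mat_mult_transpose[OF A], rule P_mat_transpose_mult[OF A])

lemma PiA_PAT: "PiA * PA\<^sup>T = PA\<^sup>T"
  unfolding PA_simps(2)[symmetric] by (simp add: mult_assoc_dim PA_simps(1))

lemma M_transpose [simp]: "M\<^sup>T = M"
  by (subst (1 2) M_mat_diag) (rule mat_diag_transpose)

lemma PiA_Mi_PiA: "PiA * Mi * PiA = Mi * PiA"
  unfolding mat_diags by (intro mat_diag_cong) simp

lemma PiA_Mi: "PiA * Mi = Mi * PiA"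
  unfolding mat_diags by (intro mat_diag_cong) simp

lemma PiI_plus_PiA: "PiI + PiA = 1\<^sub>m n"
  using A_eq by (intro eq_matI) (auto simp: Pi_mat_def mat_diag_def)

text \<open>The blocks of the approximate Schur complement of the augmented system, which is a congruence by the
unit triangular matrix \<open>U\<close> of \<open>diag(G G\<^sup>T, E)\<close>, up to the factor \<open>1/\<alpha>\<close>.\<close>

definition E :: "real mat" where "E = PA * M * PA\<^sup>T"
definition V :: "real mat" where "V = Mb * PiA * Mi * PA\<^sup>T"
definition U :: "real mat" where "U = four_block_mat (1\<^sub>m n) (- V) (0\<^sub>m a n) (1\<^sub>m a)"

text \<open>\<open>F_aug\<close> and \<open>R_aug\<close> split the approximate Schur complement of the augmented system in the middle.
The block \<open>E\<close> goes to the left factor as a whole, which avoids a square root of it; this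
asymmetry is harmless, as only the invertibility of both factors matters.\<close>

definition F_aug :: "real mat" where
  "F_aug = (1 / \<alpha>) \<cdot>\<^sub>m (U * four_block_mat G (0\<^sub>m n a) (0\<^sub>m a n) E)"
definition R_aug :: "real mat" where
  "R_aug = four_block_mat G\<^sup>T (0\<^sub>m n a) (0\<^sub>m a n) (1\<^sub>m a) * U\<^sup>T"
definition H_aug :: "real mat" where
  "H_aug = four_block_mat H (0\<^sub>m n a) (0\<^sub>m a n) (1\<^sub>m a)"

lemma E_V_carrier: "E \<in> carrier_mat a a" "V \<in> carrier_mat n a"
  unfolding E_def V_def by (rule carrier_matI; simp)+

lemma U_carrier: "U \<in> carrier_mat (n + a) (n + a)" "U\<^sup>T \<in> carrier_mat (n + a) (n + a)"
  unfolding U_def by (rule carrier_matI; simp)+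

lemma E_transpose: "E\<^sup>T = E"
proof -
  have "E\<^sup>T = (PA\<^sup>T)\<^sup>T * (PA * M)\<^sup>T"
    unfolding E_def by (rule transpose_mult[of _ a n _ a]) (rule carrier_matI; simp)+
  also have "(PA * M)\<^sup>T = M * PA\<^sup>T"
    using transpose_mult[OF carriers(4) M] by simp
  finally show ?thesis by (simp add: E_def mult_assoc_dim)
qed

lemma V_E: "V * E = Mb * PA\<^sup>T"
proof -
  have "V * E = Mb * ((PiA * Mi * (PA\<^sup>T * PA)) * M) * PA\<^sup>T"
    by (simp add: V_def E_def mult_assoc_dim)
  also have "PiA * Mi * (PA\<^sup>T * PA) = PiA * Mi"
    unfolding PA_simps PiA_Mi_PiA by (rule PiA_Mi[symmetric])
  also have "PiA * Mi * M = PiA" by (simp add: mult_assoc_dim Mi_M)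
  finally show ?thesis by (simp add: mult_assoc_dim PiA_PAT)
qed

lemma det_E: "det E \<noteq> 0"
proof (rule det_nonzero_if_right_inverse[OF E_V_carrier(1)])
  show "PA * Mi * PA\<^sup>T \<in> carrier_mat a a" by (rule carrier_matI; simp)
  have "E * (PA * Mi * PA\<^sup>T) = PA * (M * ((PA\<^sup>T * PA) * Mi)) * PA\<^sup>T"
    by (simp add: E_def mult_assoc_dim)
  also have "M * ((PA\<^sup>T * PA) * Mi) = M * Mi * PiA"
    unfolding PA_simps PiA_Mi by (simp add: mult_assoc_dim)
  finally show "E * (PA * Mi * PA\<^sup>T) = 1\<^sub>m a"
    by (simp add: M_Mi mult_assoc_dim PiA_PAT PA_simps)
qed

lemma E_V: "E * V\<^sup>T = PA * Mb\<^sup>T"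
proof -
  have "E * V\<^sup>T = (V * E)\<^sup>T" using transpose_mult[OF E_V_carrier(2,1)] by (simp add: E_transpose)
  also have "\<dots> = (PA\<^sup>T)\<^sup>T * Mb\<^sup>T"
    unfolding V_E by (rule transpose_mult[of _ n n _ a]) (rule carrier_matI; simp)+
  finally show ?thesis by simp
qed

lemma V_E_V: "V * (E * V\<^sup>T) = Mb * Mi * PiA * Mb\<^sup>T"
proof -
  have "V * (E * V\<^sup>T) = Mb * (PiA * Mi * (PA\<^sup>T * PA)) * Mb\<^sup>T"
    unfolding E_V by (simp add: V_def mult_assoc_dim)
  then show ?thesis
    unfolding PA_simps PiA_Mi_PiA by (simp add: mult_assoc_dim)
qed

text \<open>The congruence by \<open>U\<close> adds the active part \<open>Mb M\<inverse> \<Pi>\<^sub>A Mb\<^sup>T\<close> to the leading block and creates the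
coupling blocks. It does so for every leading block \<open>D\<close>, so it serves the approximate and the true
Schur complement alike.\<close>

lemma U_D_U:
  assumes D: "D \<in> carrier_mat n n"
  shows "U * four_block_mat D (0\<^sub>m n a) (0\<^sub>m a n) E * U\<^sup>T
    = four_block_mat (D + Mb * Mi * PiA * Mb\<^sup>T) (- (Mb * PA\<^sup>T)) (- (PA * Mb\<^sup>T)) E"
proof -
  note c = one_carrier_mat[of n] one_carrier_mat[of a] zero_carrier_mat[of n a] zero_carrier_mat[of a n]
  have MP: "- (Mb * PA\<^sup>T) \<in> carrier_mat n a" "- (PA * Mb\<^sup>T) \<in> carrier_mat a n"
    by (rule carrier_matI; simp)+
  have nV: "- V \<in> carrier_mat n a" "- (V\<^sup>T) \<in> carrier_mat a n" "- (V * E) \<in> carrier_mat n a"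
    using E_V_carrier by auto
  have Ut: "U\<^sup>T = four_block_mat (1\<^sub>m n) (0\<^sub>m n a) (- (V\<^sup>T)) (1\<^sub>m a)"
    unfolding U_def transpose_four_block_mat[OF c(1) nV(1) c(4,2)] by (simp add: transpose_uminus)
  have 1: "U * four_block_mat D (0\<^sub>m n a) (0\<^sub>m a n) E = four_block_mat D (- (V * E)) (0\<^sub>m a n) E"
    unfolding U_def mult_four_block_mat[OF c(1) nV(1) c(4,2) D c(3,4) E_V_carrier(1)]
    using D E_V_carrier by (intro cong_four_block_mat) auto
  have "- (V * E) * - (V\<^sup>T) = Mb * Mi * PiA * Mb\<^sup>T"
    using E_V_carrier by (simp add: mult_assoc_dim V_E_V)
  moreover have "E * - (V\<^sup>T) = - (PA * Mb\<^sup>T)" using E_V_carrier by (simp add: E_V)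
  ultimately show ?thesis
    unfolding 1 Ut mult_four_block_mat[OF D nV(3) c(4) E_V_carrier(1) c(1,3) nV(2) c(2)]
    using D E_V_carrier by (intro cong_four_block_mat) (simp_all add: V_E left_add_zero_mat[OF MP(1)] left_add_zero_mat[OF MP(2)])
qed

abbreviation K :: "real mat" where "K \<equiv> J11 n \<alpha> M"
abbreviation B :: "real mat" where "B \<equiv> J12 n M L Mb A"
definition Ki :: "real mat" where
  "Ki = four_block_mat Mi (0\<^sub>m n n) (0\<^sub>m n n) ((1 / \<alpha>) \<cdot>\<^sub>m Mi)"

lemma K_Ki_B_carrier: "K \<in> carrier_mat (2 * n) (2 * n)" "Ki \<in> carrier_mat (2 * n) (2 * n)"
  "B \<in> carrier_mat (n + a) (2 * n)"
  unfolding J11_def J12_def Ki_def by (rule carrier_matI; simp)+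

lemma K_Ki: "K * Ki = 1\<^sub>m (2 * n)"
proof -
  have c: "\<alpha> \<cdot>\<^sub>m M \<in> carrier_mat n n" "(1 / \<alpha>) \<cdot>\<^sub>m Mi \<in> carrier_mat n n"
    using M by auto
  have "(\<alpha> \<cdot>\<^sub>m M) * ((1 / \<alpha>) \<cdot>\<^sub>m Mi) = \<alpha> \<cdot>\<^sub>m (M * ((1 / \<alpha>) \<cdot>\<^sub>m Mi))"
    by (rule mult_smult_assoc_mat[OF M c(2)])
  also have "M * ((1 / \<alpha>) \<cdot>\<^sub>m Mi) = (1 / \<alpha>) \<cdot>\<^sub>m (M * Mi)"
    by (rule mult_smult_distrib[OF M carriers(1)])
  finally have 1: "(\<alpha> \<cdot>\<^sub>m M) * ((1 / \<alpha>) \<cdot>\<^sub>m Mi) = 1\<^sub>m n"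
    using \<alpha>_pos by (simp add: smult_smult_mat M_Mi) (rule eq_matI; simp)
  have "K * Ki = four_block_mat (1\<^sub>m n) (0\<^sub>m n n) (0\<^sub>m n n) (1\<^sub>m n)"
    unfolding J11_def Ki_def
      mult_four_block_mat[OF M zero_carrier_mat zero_carrier_mat c(1) carriers(1)
        zero_carrier_mat zero_carrier_mat c(2)]
    using M c by (intro cong_four_block_mat) (simp_all add: 1 M_Mi)
  then show ?thesis by (simp add: mult_2)
qed

lemma Ki_K: "Ki * K = 1\<^sub>m (2 * n)"
  by (rule mat_mult_left_right_inverse[OF K_Ki_B_carrier(1,2) K_Ki])

lemma minv_K: "minv K = Ki"
  by (rule minv_eqI[OF K_Ki_B_carrier(1,2) K_Ki])

lemma B_transpose:
  "B\<^sup>T = four_block_mat L\<^sup>T (0\<^sub>m n a) (- (Mb\<^sup>T)) (M * PA\<^sup>T)"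
proof -
  have "- Mb \<in> carrier_mat n n" "PA * M \<in> carrier_mat a n" by (rule carrier_matI; simp)+
  moreover have "(PA * M)\<^sup>T = M * PA\<^sup>T" using transpose_mult[OF carriers(4) M] by simp
  ultimately show ?thesis
    unfolding J12_def using transpose_four_block_mat[OF L _ zero_carrier_mat[of a n], of "- Mb" n "PA * M"]
    by (simp add: transpose_uminus)
qed

text \<open>The lower right block of the augmented matrix is zero, so this product is its Schur complement up
to sign. The whole \<open>M\<inverse>\<close> appears in the leading block, where the reduced system has \<open>M\<inverse> \<Pi>\<^sub>I\<close>.\<close>

lemma B_Ki_B:
  "B * Ki * B\<^sup>T = (1 / \<alpha>) \<cdot>\<^sub>m
     four_block_mat (\<alpha> \<cdot>\<^sub>m (L * Mi * L\<^sup>T) + Mb * Mi * Mb\<^sup>T) (- (Mb * PA\<^sup>T)) (- (PA * Mb\<^sup>T)) E"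
proof -
  let ?c = "1 / \<alpha>"
  have c: "- Mb \<in> carrier_mat n n" "PA * M \<in> carrier_mat a n" "?c \<cdot>\<^sub>m Mi \<in> carrier_mat n n"
    "L * Mi \<in> carrier_mat n n" "- (?c \<cdot>\<^sub>m (Mb * Mi)) \<in> carrier_mat n n" "?c \<cdot>\<^sub>m PA \<in> carrier_mat a n"
    "L\<^sup>T \<in> carrier_mat n n" "- (Mb\<^sup>T) \<in> carrier_mat n n" "M * PA\<^sup>T \<in> carrier_mat n a"
    "Mb * Mi \<in> carrier_mat n n" "Mb\<^sup>T \<in> carrier_mat n n" "Mb * Mi * Mb\<^sup>T \<in> carrier_mat n n"
    "PA * Mb\<^sup>T \<in> carrier_mat a n" "E \<in> carrier_mat a a" "Mb * PA\<^sup>T \<in> carrier_mat n a"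
    by (rule carrier_matI; simp add: E_def)+
  have "- Mb * (?c \<cdot>\<^sub>m Mi) = - (?c \<cdot>\<^sub>m (Mb * Mi))"
    using Mb mult_smult_distrib[OF Mb carriers(1), of ?c] by simp
  moreover have "(PA * M) * (?c \<cdot>\<^sub>m Mi) = ?c \<cdot>\<^sub>m PA"
  proof -
    have "(PA * M) * (?c \<cdot>\<^sub>m Mi) = ?c \<cdot>\<^sub>m (PA * M * Mi)"
      by (rule mult_smult_distrib[OF c(2) carriers(1)])
    then show ?thesis by (simp add: mult_assoc_dim M_Mi)
  qed
  ultimately have 1: "B * Ki = four_block_mat (L * Mi) (- (?c \<cdot>\<^sub>m (Mb * Mi))) (0\<^sub>m a n) (?c \<cdot>\<^sub>m PA)"
    unfolding J12_def Ki_def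
      mult_four_block_mat[OF L c(1) zero_carrier_mat c(2) carriers(1) zero_carrier_mat
        zero_carrier_mat c(3)]
    using c L Mb by (intro cong_four_block_mat) (simp_all add: left_add_zero_mat[OF c(5)])
  have 2: "- (?c \<cdot>\<^sub>m (Mb * Mi)) * - (Mb\<^sup>T) = ?c \<cdot>\<^sub>m (Mb * Mi * Mb\<^sup>T)"
    using mult_smult_assoc_mat[OF c(10,11), of ?c] by simp
  have 3: "- (?c \<cdot>\<^sub>m (Mb * Mi)) * (M * PA\<^sup>T) = ?c \<cdot>\<^sub>m (- (Mb * PA\<^sup>T))"
  proof -
    have "(?c \<cdot>\<^sub>m (Mb * Mi)) * (M * PA\<^sup>T) = ?c \<cdot>\<^sub>m (Mb * Mi * (M * PA\<^sup>T))"
      by (rule mult_smult_assoc_mat[OF c(10,9)])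
    also have "Mb * Mi * (M * PA\<^sup>T) = Mb * ((Mi * M) * PA\<^sup>T)" by (simp add: mult_assoc_dim)
    also have "\<dots> = Mb * PA\<^sup>T" by (simp add: Mi_M)
    finally show ?thesis by (simp add: smult_mat_uminus)
  qed
  have 4: "(?c \<cdot>\<^sub>m PA) * - (Mb\<^sup>T) = ?c \<cdot>\<^sub>m (- (PA * Mb\<^sup>T))"
    using mult_smult_assoc_mat[OF carriers(4) c(11), of ?c] by (simp add: smult_mat_uminus)
  have 5: "(?c \<cdot>\<^sub>m PA) * (M * PA\<^sup>T) = ?c \<cdot>\<^sub>m E"
    using mult_smult_assoc_mat[OF carriers(4) c(9), of ?c] by (simp add: E_def mult_assoc_dim)
  have 6: "L * Mi * L\<^sup>T + ?c \<cdot>\<^sub>m (Mb * Mi * Mb\<^sup>T)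
      = ?c \<cdot>\<^sub>m (\<alpha> \<cdot>\<^sub>m (L * Mi * L\<^sup>T) + Mb * Mi * Mb\<^sup>T)"
    using \<alpha>_pos by (intro eq_matI) (simp_all del: index_mult_mat(1) add: field_simps)
  have nc: "- (Mb * PA\<^sup>T) \<in> carrier_mat n a" "- (PA * Mb\<^sup>T) \<in> carrier_mat a n"
    "\<alpha> \<cdot>\<^sub>m (L * Mi * L\<^sup>T) + Mb * Mi * Mb\<^sup>T \<in> carrier_mat n n"
    by (rule carrier_matI; simp)+
  show ?thesis
    unfolding 1 B_transpose smult_four_block_mat[OF nc(3,1,2) c(14)]
      mult_four_block_mat[OF c(4,5) zero_carrier_mat c(6) c(7) zero_carrier_mat c(8,9)] 2 3 4 5 6
    using c nc by (intro cong_four_block_mat) (simp_all add: left_add_zero_mat)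
qed

lemma factor_carriers_aug: "F_aug \<in> carrier_mat (n + a) (n + a)" "R_aug \<in> carrier_mat (n + a) (n + a)"
  "H_aug \<in> carrier_mat (n + a) (n + a)"
  unfolding F_aug_def R_aug_def H_aug_def using U_carrier Z_Q_H_G_carrier E_V_carrier by auto

lemma det_F_aug: "det F_aug \<noteq> 0" and det_R_aug: "det R_aug \<noteq> 0"
proof -
  have "det U = 1"
    unfolding U_def using E_V_carrier by (subst det_four_block_mat_lower_left_zero[of _ n _ a]) auto
  moreover have "det (four_block_mat G (0\<^sub>m n a) (0\<^sub>m a n) E) = det G * det E"
    by (rule det_four_block_mat_lower_left_zero[OF Z_Q_H_G_carrier(4) zero_carrier_mat refl E_V_carrier(1)])
  moreover have "det (four_block_mat G\<^sup>T (0\<^sub>m n a) (0\<^sub>m a n) (1\<^sub>m a)) = det G"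
    using Z_Q_H_G_carrier(4) by (subst det_four_block_mat_lower_left_zero[of _ n _ a]) (auto simp: det_transpose)
  moreover have "four_block_mat G (0\<^sub>m n a) (0\<^sub>m a n) E \<in> carrier_mat (n + a) (n + a)"
    "four_block_mat G\<^sup>T (0\<^sub>m n a) (0\<^sub>m a n) (1\<^sub>m a) \<in> carrier_mat (n + a) (n + a)"
    using Z_Q_H_G_carrier(4) E_V_carrier by auto
  ultimately show "det F_aug \<noteq> 0" "det R_aug \<noteq> 0"
    unfolding F_aug_def R_aug_def using U_carrier det_G det_E \<alpha>_pos
    by (simp_all add: det_smult det_mult[of _ "n + a"] det_transpose)
qed

lemma F_X_R:
  assumes X: "X' \<in> carrier_mat n n"
  shows "F_aug * four_block_mat X' (0\<^sub>m n a) (0\<^sub>m a n) (1\<^sub>m a) * R_aug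
    = (1 / \<alpha>) \<cdot>\<^sub>m (U * four_block_mat (G * X' * G\<^sup>T) (0\<^sub>m n a) (0\<^sub>m a n) E * U\<^sup>T)"
proof -
  let ?d = "\<lambda>P Q. four_block_mat P (0\<^sub>m n a) (0\<^sub>m a n) Q"
  have d: "?d P S * ?d P' S' = ?d (P * P') (S * S')"
    if "P \<in> carrier_mat n n" "S \<in> carrier_mat a a" "P' \<in> carrier_mat n n" "S' \<in> carrier_mat a a"
    for P S P' S'
    using that by (subst mult_four_block_mat[of _ n n _ a _ a _ _ n _ a]) auto
  have GXG: "?d G E * (?d X' (1\<^sub>m a) * ?d G\<^sup>T (1\<^sub>m a)) = ?d (G * X' * G\<^sup>T) E"
    using X Z_Q_H_G_carrier(4) E_V_carrier(1) by (simp add: d assoc_mult_mat[of _ n n _ n _ n])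
  have Ud: "dim_row U = n + a" "dim_col U = n + a" "dim_row G = n" "dim_col G = n"
    "dim_row E = a" "dim_col E = a" "dim_row X' = n" "dim_col X' = n"
    using U_carrier E_V_carrier Z_Q_H_G_carrier(4) X by auto
  have "F_aug * ?d X' (1\<^sub>m a) * R_aug
      = (1 / \<alpha>) \<cdot>\<^sub>m (U * ?d G E * (?d X' (1\<^sub>m a) * R_aug))"
  proof -
    have UG: "U * ?d G E \<in> carrier_mat (n + a) (n + a)"
      "?d X' (1\<^sub>m a) \<in> carrier_mat (n + a) (n + a)"
      "?d X' (1\<^sub>m a) * R_aug \<in> carrier_mat (n + a) (n + a)"
      using U_carrier Z_Q_H_G_carrier(4) E_V_carrier(1) X factor_carriers_aug by auto
    have "F_aug * ?d X' (1\<^sub>m a) * R_aug = F_aug * (?d X' (1\<^sub>m a) * R_aug)"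
      by (rule assoc_mult_mat[OF factor_carriers_aug(1) UG(2) factor_carriers_aug(2)])
    also have "\<dots> = (1 / \<alpha>) \<cdot>\<^sub>m (U * ?d G E * (?d X' (1\<^sub>m a) * R_aug))"
      unfolding F_aug_def by (rule mult_smult_assoc_mat[OF UG(1,3)])
    finally show ?thesis .
  qed
  also have "U * ?d G E * (?d X' (1\<^sub>m a) * R_aug)
      = U * (?d G E * (?d X' (1\<^sub>m a) * ?d G\<^sup>T (1\<^sub>m a))) * U\<^sup>T"
    unfolding R_aug_def by (simp add: mult_assoc_dim Ud)
  finally show ?thesis unfolding GXG .
qed

lemma S_aug_hat_eq: "S_aug_hat n \<alpha> M L Mb I A = F_aug * R_aug"
proof -
  have "F_aug * R_aug = F_aug * four_block_mat (1\<^sub>m n) (0\<^sub>m n a) (0\<^sub>m a n) (1\<^sub>m a) * R_aug"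
    using factor_carriers_aug by simp
  also have "\<dots> = (1 / \<alpha>) \<cdot>\<^sub>m (U * four_block_mat (G * 1\<^sub>m n * G\<^sup>T) (0\<^sub>m n a) (0\<^sub>m a n) E * U\<^sup>T)"
    by (rule F_X_R) simp
  also have "\<dots> = S_aug_hat n \<alpha> M L Mb I A"
    using Z_Q_H_G_carrier(4) unfolding S_aug_hat_def Let_def S_red_hat_eq U_def V_def E_def by simp
  finally show ?thesis by simp
qed

text \<open>The congruence by \<open>U\<close> supplies the \<open>\<Pi>\<^sub>A\<close> part of \<open>Mb M\<inverse> Mb\<^sup>T\<close> and the reduced Schur complement
\<open>G H G\<^sup>T\<close> the \<open>\<Pi>\<^sub>I\<close> part. Since \<open>I\<close> and \<open>A\<close> are complementary, the two add up.\<close>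

lemma Schur_complement_aug: "F_aug * H_aug * R_aug = B * Ki * B\<^sup>T"
proof -
  have GHG: "G * H * G\<^sup>T \<in> carrier_mat n n" using Z_Q_H_G_carrier by auto
  have "Mb * Mi * PiI * Mb\<^sup>T + Mb * Mi * PiA * Mb\<^sup>T = Mb * Mi * (PiI + PiA) * Mb\<^sup>T"
  proof -
    have c: "Mb * Mi \<in> carrier_mat n n" "Mb * Mi * PiI \<in> carrier_mat n n"
      "Mb * Mi * PiA \<in> carrier_mat n n" "Mb\<^sup>T \<in> carrier_mat n n"
      by (rule carrier_matI; simp)+
    show ?thesis
      unfolding mult_add_distrib_mat[OF c(1) carriers(3,3)] add_mult_distrib_mat[OF c(2,3,4)] ..
  qed
  also have "\<dots> = Mb * Mi * Mb\<^sup>T" unfolding PiI_plus_PiA by (simp add: mult_assoc_dim)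
  finally have "\<alpha> \<cdot>\<^sub>m (L * Mi * L\<^sup>T) + Mb * Mi * PiI * Mb\<^sup>T + Mb * Mi * PiA * Mb\<^sup>T
      = \<alpha> \<cdot>\<^sub>m (L * Mi * L\<^sup>T) + Mb * Mi * Mb\<^sup>T"
    by (subst assoc_add_mat[of _ n n]) (rule carrier_matI; simp | simp)+
  then show ?thesis
    unfolding H_aug_def F_X_R[OF Z_Q_H_G_carrier(3)] U_D_U[OF GHG] unfolding G_H_G B_Ki_B by simp
qed

lemma char_poly_augmented:
  defines "T \<equiv> minv (IPF_aug n \<alpha> M L Mb I A) * J_aug n \<alpha> M L Mb A"
  shows "T \<in> carrier_mat (2 * n + (n + a)) (2 * n + (n + a))"
    and "char_poly T = [:-1, 1:] ^ (2 * n + a) * char_poly H"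
proof -
  have S: "F_aug * R_aug \<in> carrier_mat (n + a) (n + a)" using factor_carriers_aug by auto
  have IPF: "IPF_aug n \<alpha> M L Mb I A = four_block_mat K B\<^sup>T B (B * Ki * B\<^sup>T - F_aug * R_aug)"
    unfolding IPF_aug_def Let_def minv_K S_aug_hat_eq
    by (rule indefinite_factorization_product[OF K_Ki_B_carrier(1,2) K_Ki Ki_K K_Ki_B_carrier(3) S])
  have "B * Ki * B\<^sup>T \<in> carrier_mat (n + a) (n + a)" using K_Ki_B_carrier by (auto intro!: carrier_matI)
  then have "J_aug n \<alpha> M L Mb A = four_block_mat K B\<^sup>T B (B * Ki * B\<^sup>T - F_aug * H_aug * R_aug)"
    unfolding Schur_complement_aug B_transpose unfolding J_aug_def J11_def J12_def by simp
  then have T: "T = minv (four_block_mat K B\<^sup>T B (B * Ki * B\<^sup>T - F_aug * R_aug))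
      * four_block_mat K B\<^sup>T B (B * Ki * B\<^sup>T - F_aug * H_aug * R_aug)"
    unfolding T_def IPF by simp
  note main = char_poly_indefinite_preconditioned[OF K_Ki_B_carrier(1,2) K_Ki Ki_K K_Ki_B_carrier(3) factor_carriers_aug(1)
      det_F_aug factor_carriers_aug(2) det_R_aug factor_carriers_aug(3), folded T]
  show "T \<in> carrier_mat (2 * n + (n + a)) (2 * n + (n + a))" by (rule main(1))
  have "char_poly H_aug = char_poly H * [:-1, 1:] ^ a"
    unfolding H_aug_def char_poly_four_block_diag[OF Z_Q_H_G_carrier(3) one_carrier_mat] char_poly_one ..
  then show "char_poly T = [:-1, 1:] ^ (2 * n + a) * char_poly H"
    unfolding main(2) by (simp add: power_add mult_ac)
qed

end

theorem proposition4p5: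
  fixes n :: nat and L Mb M :: "real mat" and I A :: "nat set" and \<alpha> \<zeta> :: real
  assumes "n \<ge> 1"
    and "L \<in> carrier_mat n n" and "Mb \<in> carrier_mat n n" and "M \<in> carrier_mat n n"
    and "diagonal_mat M" and "\<forall>i<n. M $$ (i, i) > 0"
    and "I \<subseteq> {..<n}" and "A = {..<n} - I"
    and "\<alpha> > 0"
    and "invertible_mat (sqrt \<alpha> \<cdot>\<^sub>m L + Mb * Pi_mat n I)"
    and "\<zeta> = zeta n \<alpha> M L Mb I"
  shows
    "((\<forall>ev. eigenvalue (cmat (minv (IPF_aug n \<alpha> M L Mb I A) * J_aug n \<alpha> M L Mb A)) ev \<longrightarrow>
            ev \<in> complex_of_real ` ({1} \<union> {1/2 .. \<zeta>\<^sup>2 + (1 + \<zeta>)\<^sup>2})) \<and>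
      int (alg_mult (cmat (minv (IPF_aug n \<alpha> M L Mb I A) * J_aug n \<alpha> M L Mb A)) 1)
        \<ge> 3 * int n + int (card A) - 2 * int (card I))
     \<and>
     ((\<forall>ev. eigenvalue (cmat (minv (IPF_red n \<alpha> M L Mb I) * J_red n \<alpha> M L Mb I)) ev \<longrightarrow>
            ev \<in> complex_of_real ` ({1} \<union> {1/2 .. \<zeta>\<^sup>2 + (1 + \<zeta>)\<^sup>2})) \<and>
      int (alg_mult (cmat (minv (IPF_red n \<alpha> M L Mb I) * J_red n \<alpha> M L Mb I)) 1)
        \<ge> 2 * int n - 2 * int (card I))"
proof -
  interpret optimality_system n L Mb M I A \<alpha>
    using assms(2-10) by unfold_locales
  show ?thesis
    using spectrum_from_H[OF char_poly_augmented assms(11)]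
      spectrum_from_H[OF char_poly_reduced assms(11)]
    by (simp add: algebra_simps)
qed

end
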